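(* Let $v \in S_n$ avoid $1324$ and $2143$, and let $k$ be the size of the largest square region contained in $\Gamma_{[v,w_0]}$. Then for every $k$-positive $n \times n$ matrix $M$, $(-1)^{\ell(v)} \det\left(M|_{\Gamma_{[v,w_0]}}\right) > 0$.
   Context: $S_n$ is the symmetric group in one-line notation, $\ell$ is length, $\leq$ is Bruhat order, and $w_0$ is the longest element. $\Gamma_{[v,w]} := \{(i,u_i): u\in[v,w], i\in[n]\}\subseteq[n]^2$, where $(i,j)$ is row $i$, column $j$, rows numbered top to bottom. A square region of size $k$ is a set $[a,a+k-1]\times[b,b+k-1]$. Pattern containment/avoidance is the usual notion for permutations. A matrix is $k$-positive if all its minors of size at most $k$ are positive. For $Q\subseteq[n]^2$ and $M=(m_{ij})$, the restriction $M|_Q$ is the matrix whose $(i,j)$ entry is $m_{ij}$ if $(i,j)\in Q$ and $0$ otherwise. *)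

theory Defs
  imports
    "HOL-Combinatorics.Permutations"
    "Jordan_Normal_Form.Determinant"
    "Jordan_Normal_Form.DL_Submatrix"
begin

text \<open>
  Matrices are indexed from 0 here, so everything is shifted by one: $[n]$ becomes
  \<open>{..<n}\<close>, and an element of $S_n$ is a function \<open>w\<close> with \<open>w permutes {..<n}\<close>, whose
  one-line notation is \<open>w 0, ..., w (n - 1)\<close>.
\<close>

definition perm_length :: "nat \<Rightarrow> (nat \<Rightarrow> nat) \<Rightarrow> nat" where
  "perm_length n w = card {(i, j). i < j \<and> j < n \<and> w j < w i}"

definition bruhat_step :: "nat \<Rightarrow> ((nat \<Rightarrow> nat) \<times> (nat \<Rightarrow> nat)) set" where
  "bruhat_step n = {(u, w). u permutes {..<n} \<and>
     (\<exists>i j. i < j \<and> j < n \<and> w = u \<circ> transpose i j \<and> perm_length n u < perm_length n w)}"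

definition bruhat_le :: "nat \<Rightarrow> (nat \<Rightarrow> nat) \<Rightarrow> (nat \<Rightarrow> nat) \<Rightarrow> bool" where
  "bruhat_le n u w \<longleftrightarrow> u permutes {..<n} \<and> w permutes {..<n} \<and> (u, w) \<in> (bruhat_step n)\<^sup>*"

definition bruhat_interval :: "nat \<Rightarrow> (nat \<Rightarrow> nat) \<Rightarrow> (nat \<Rightarrow> nat) \<Rightarrow> (nat \<Rightarrow> nat) set" where
  "bruhat_interval n v w = {u. bruhat_le n v u \<and> bruhat_le n u w}"

definition longest_perm :: "nat \<Rightarrow> nat \<Rightarrow> nat" where
  "longest_perm n = (ARG_MAX (perm_length n) w. w permutes {..<n})"

definition contains_pattern :: "nat \<Rightarrow> (nat \<Rightarrow> nat) \<Rightarrow> nat list \<Rightarrow> bool" where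
  "contains_pattern n w p \<longleftrightarrow>
     (\<exists>f. strict_mono_on {..<length p} f \<and> f ` {..<length p} \<subseteq> {..<n} \<and>
        (\<forall>a<length p. \<forall>b<length p. w (f a) < w (f b) \<longleftrightarrow> p ! a < p ! b))"

abbreviation avoids_pattern :: "nat \<Rightarrow> (nat \<Rightarrow> nat) \<Rightarrow> nat list \<Rightarrow> bool" where
  "avoids_pattern n w p \<equiv> \<not> contains_pattern n w p"

definition Gamma_region :: "nat \<Rightarrow> (nat \<Rightarrow> nat) \<Rightarrow> (nat \<Rightarrow> nat) \<Rightarrow> (nat \<times> nat) set" where
  "Gamma_region n v w = {(i, u i) | i u. u \<in> bruhat_interval n v w \<and> i < n}"

definition square_region :: "nat \<Rightarrow> nat \<Rightarrow> nat \<Rightarrow> (nat \<times> nat) set" where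
  "square_region a b k = {a..<a + k} \<times> {b..<b + k}"

text \<open>Size 0 (the empty region) is admitted, so for finite \<open>Q\<close> the maximum always exists.\<close>

definition max_square_size :: "(nat \<times> nat) set \<Rightarrow> nat" where
  "max_square_size Q = Max {k. \<exists>a b. square_region a b k \<subseteq> Q}"

definition k_positive :: "nat \<Rightarrow> real mat \<Rightarrow> bool" where
  "k_positive k M \<longleftrightarrow>
     (\<forall>I J. I \<subseteq> {..<dim_row M} \<and> J \<subseteq> {..<dim_col M} \<and> card I = card J \<and> card I \<le> k
        \<longrightarrow> 0 < det (submatrix M I J))"

definition mat_restrict :: "(nat \<times> nat) set \<Rightarrow> real mat \<Rightarrow> real mat" where
  "mat_restrict Q M =
     mat (dim_row M) (dim_col M) (\<lambda>(i, j). if (i, j) \<in> Q then M $$ (i, j) else 0)"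

definition reverse_perm :: "nat \<Rightarrow> nat \<Rightarrow> nat" where
  "reverse_perm n i = (if i < n then n - 1 - i else i)"

lemma reverse_perm_permutes: "reverse_perm n permutes {..<n}"
  by (rule bij_imp_permutes, rule bij_betwI[where g = "reverse_perm n"])
     (auto simp: reverse_perm_def)

lemma finite_pairs: "finite {(i, j). i < j \<and> j < (n::nat)}"
  by (rule finite_subset[of _ "{..<n} \<times> {..<n}"]) auto

lemma perm_length_le: "perm_length n w \<le> card {(i, j). i < j \<and> j < n}"
  unfolding perm_length_def by (rule card_mono[OF finite_pairs]) auto

lemma perm_length_reverse: "perm_length n (reverse_perm n) = card {(i, j). i < j \<and> j < n}"
  unfolding perm_length_def by (rule arg_cong[where f = card]) (auto simp: reverse_perm_def)

lemma perm_length_eq_max_imp_reverse: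
  assumes w: "w permutes {..<n}" and eq: "perm_length n w = card {(i, j). i < j \<and> j < n}"
  shows "w = reverse_perm n"
proof
  fix i
  have "{(i, j). i < j \<and> j < n \<and> w j < w i} = {(i, j). i < j \<and> j < n}"
    by (rule card_subset_eq[OF finite_pairs]) (use eq in \<open>auto simp: perm_length_def\<close>)
  hence dec: "w b < w a" if "a < b" "b < n" for a b
    using that by auto
  show "w i = reverse_perm n i"
  proof (cases "i < n")
    case True
    hence wi: "w i < n" using permutes_in_image[OF w, of i] by simp
    have "w ` {i<..<n} = {..<w i}"
    proof
      show "w ` {i<..<n} \<subseteq> {..<w i}" using dec by auto
      show "{..<w i} \<subseteq> w ` {i<..<n}"
      proof
        fix y assume y: "y \<in> {..<w i}"
        hence "y \<in> w ` {..<n}" using wi permutes_image[OF w] by auto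
        then obtain j where j: "j < n" "y = w j" by auto
        have "i < j" using dec[of j i] y j True by (cases i j rule: linorder_cases) auto
        thus "y \<in> w ` {i<..<n}" using j by auto
      qed
    qed
    moreover have "inj_on w {i<..<n}"
      using permutes_inj[OF w] by (rule inj_on_subset) simp
    ultimately have "n - Suc i = w i"
      using card_image[of w "{i<..<n}"] by simp
    thus ?thesis using True by (simp add: reverse_perm_def)
  next
    case False
    thus ?thesis using permutes_not_in[OF w, of i] by (simp add: reverse_perm_def)
  qed
qed

lemma longest_perm_eq: "longest_perm n = reverse_perm n"
proof -
  have "is_arg_max (perm_length n) (\<lambda>w. w permutes {..<n}) (reverse_perm n)"
    using perm_length_le[of n] reverse_perm_permutes[of n] perm_length_reverse[of n]
    by (simp add: is_arg_max_linorder)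
  hence "is_arg_max (perm_length n) (\<lambda>w. w permutes {..<n}) (longest_perm n)"
    unfolding longest_perm_def arg_max_def
    by (rule someI[where P = "is_arg_max (perm_length n) (\<lambda>w. w permutes {..<n})"])
  hence "longest_perm n permutes {..<n}"
    and "perm_length n (reverse_perm n) \<le> perm_length n (longest_perm n)"
    using reverse_perm_permutes[of n] by (auto simp: is_arg_max_linorder)
  thus ?thesis
    using perm_length_eq_max_imp_reverse perm_length_le[of n "longest_perm n"]
      perm_length_reverse[of n] by simp
qed

lemma Gamma_region_subset: "Gamma_region n v w \<subseteq> {..<n} \<times> {..<n}"
proof -
  have "u i < n" if "u permutes {..<n}" "i < n" for u i
    using permutes_in_image[OF that(1), of i] that(2) by simp
  thus ?thesis
    by (auto simp: Gamma_region_def bruhat_interval_def bruhat_le_def)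
qed

lemma finite_square_sizes:
  assumes "finite Q"
  shows "finite {k. \<exists>a b. square_region a b k \<subseteq> Q}"
proof (rule finite_subset)
  show "{k. \<exists>a b. square_region a b k \<subseteq> Q} \<subseteq> {..card Q}"
  proof safe
    fix k a b assume "square_region a b k \<subseteq> Q"
    from card_mono[OF assms this] have "k * k \<le> card Q"
      by (simp add: square_region_def)
    thus "k \<le> card Q" using le_square[of k] by linarith
  qed
qed simp

end

theory Submission
  imports Defs "Jordan_Normal_Form.Char_Poly"
begin

text \<open>
  Reverse the columns and put \<open>w = w\<^sub>0 v\<close>. Then \<open>\<Gamma>\<close> becomes the region \<open>S\<close> of all \<open>(i, j)\<close> with
  \<open>w b \<le> j \<le> w a\<close> for some \<open>a \<le> i \<le> b\<close>. It contains the diagonal and is bounded by two staircases, and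
  since \<open>w\<close> avoids \<open>3412\<close>, no \<open>3 \<times> 3\<close> minor of \<open>S\<close> consists of everything but two opposite corners.

  This class of regions is closed under deleting rows and columns, so the Desnanot--Jacobi identity on
  two suitable diagonal positions \<open>p < q\<close> gives by induction that the restricted determinant has sign
  \<open>(-1)^f\<close>, where \<open>f\<close> is the number of pairs \<open>i < j\<close> with both \<open>(i, j)\<close> and \<open>(j, i)\<close> in \<open>S\<close>. The
  two products on the right-hand side of the identity never have the same sign. The only minors of \<open>M\<close> whose
  positivity is needed are those whose entries all lie in \<open>S\<close>, and their size is at most \<open>k\<close>.

  Finally \<open>f\<close> is the number of inversions of \<open>w\<close>: since \<open>w\<close> avoids \<open>3412\<close> and \<open>4231\<close>, either \<open>w\<close>
  or its inverse decreases down to its entry \<open>0\<close>, and removing that entry removes the first row and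
  column of the region.
\<close>

section \<open>The Desnanot--Jacobi identity\<close>

text \<open>Entries are functions on all index pairs, so passing to a minor is composition with
  index maps; the size is a separate argument.\<close>

definition fdet :: "nat \<Rightarrow> (nat \<Rightarrow> nat \<Rightarrow> 'a :: comm_ring_1) \<Rightarrow> 'a" where
  "fdet n B = det (mat n n (\<lambda>(i, j). B i j))"

text \<open>\<open>insert_index p\<close> skips \<open>p\<close>, so this deletes row
  \<open>p\<close> and column \<open>q\<close>. The entry type is left open because Boolean regions
  are cut down in the same way.\<close>

definition minor_fun :: "nat \<Rightarrow> nat \<Rightarrow> (nat \<Rightarrow> nat \<Rightarrow> 'a) \<Rightarrow> nat \<Rightarrow> nat \<Rightarrow> 'a" where
  "minor_fun p q B = (\<lambda>i j. B (insert_index p i) (insert_index q j))"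

lemma fdet_cong:
  assumes "\<And>i j. i < n \<Longrightarrow> j < n \<Longrightarrow> B i j = C i j"
  shows "fdet n B = fdet n C"
  unfolding fdet_def by (rule arg_cong[where f = det], rule eq_matI) (auto simp: assms)

lemma fdet_leibniz:
  "fdet n B = (\<Sum>u | u permutes {0..<n}. signof u * (\<Prod>i = 0..<n. B i (u i)))"
proof -
  have "fdet n B = (\<Sum>u | u permutes {0..<n}. signof u *
      (\<Prod>i = 0..<n. mat n n (\<lambda>(i, j). B i j) $$ (i, u i)))"
    unfolding fdet_def by (rule det_def') simp
  also have "\<dots> = (\<Sum>u | u permutes {0..<n}. signof u * (\<Prod>i = 0..<n. B i (u i)))"
    by (intro sum.cong refl arg_cong2[where f = "(*)"] prod.cong)
      (use permutes_in_image in \<open>fastforce+\<close>)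
  finally show ?thesis .
qed

lemma insert_index_less: "i < n - 1 \<Longrightarrow> insert_index p i < n"
  by (auto simp: insert_index_def)

lemma fdet_delete:
  assumes "p < n" "q < n"
  shows "det (mat_delete (mat n n (\<lambda>(i, j). B i j)) p q) = fdet (n - 1) (minor_fun p q B)"
  unfolding fdet_def
  by (rule arg_cong[where f = det], rule eq_matI)
     (auto simp: mat_delete_def minor_fun_def insert_index_def)

lemma fdet_expand_row:
  assumes "p < n"
  shows "fdet n B = (\<Sum>j<n. B p j * (-1) ^ (p + j) * fdet (n - 1) (minor_fun p j B))"
proof -
  have "fdet n B = (\<Sum>j<n. mat n n (\<lambda>(i, j). B i j) $$ (p, j) *
      cofactor (mat n n (\<lambda>(i, j). B i j)) p j)"
    unfolding fdet_def by (rule laplace_expansion_row) (use assms in auto)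
  also have "\<dots> = (\<Sum>j<n. B p j * (-1) ^ (p + j) * fdet (n - 1) (minor_fun p j B))"
    by (rule sum.cong) (use assms in \<open>auto simp: cofactor_def fdet_delete mult.assoc\<close>)
  finally show ?thesis .
qed

lemma fdet_single_entry_row:
  assumes p: "p < n" and 0: "\<And>j. j < n \<Longrightarrow> j \<noteq> p \<Longrightarrow> B p j = 0"
  shows "fdet n B = B p p * fdet (n - 1) (minor_fun p p B)"
proof -
  have "fdet n B = (\<Sum>j<n. if j = p then B p p * fdet (n - 1) (minor_fun p p B) else 0)"
    unfolding fdet_expand_row[OF p]
    by (rule sum.cong) (auto simp: 0 simp flip: mult_2)
  thus ?thesis using p by simp
qed

text \<open>A Leibniz term survives only if its permutation fixes every index other than
  \<open>p\<close> and \<open>q\<close>, which leaves the identity and one transposition.\<close>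

lemma fdet_two_rows:
  fixes c :: "nat \<Rightarrow> nat \<Rightarrow> 'a :: comm_ring_1"
  assumes pq: "p < q" "q < n"
    and id: "\<And>i j. i < n \<Longrightarrow> j < n \<Longrightarrow> i \<noteq> p \<Longrightarrow> i \<noteq> q \<Longrightarrow> c i j = (if i = j then 1 else 0)"
  shows "fdet n c = c p p * c q q - c p q * c q p"
proof -
  let ?P = "{u. u permutes {0..<n}}" and ?t = "transpose p q"
  let ?g = "\<lambda>u. signof u * (\<Prod>i = 0..<n. c i (u i))"
  have pqn: "p \<in> {0..<n}" "q \<in> {0..<n}" "p \<noteq> q" using pq by auto
  have split: "(\<Prod>i = 0..<n. h i) = h p * h q" if "\<And>i. i < n \<Longrightarrow> i \<noteq> p \<Longrightarrow> i \<noteq> q \<Longrightarrow> h i = 1"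
    for h :: "nat \<Rightarrow> 'a"
  proof -
    have "(\<Prod>i = 0..<n. h i) = (\<Prod>i \<in> {p, q}. h i)"
      by (rule prod.mono_neutral_right) (use pqn that in auto)
    thus ?thesis using pqn by simp
  qed
  have "fdet n c = sum ?g ?P" by (rule fdet_leibniz)
  also have "\<dots> = sum ?g {id, ?t}"
  proof (rule sum.mono_neutral_right)
    show "finite ?P" by (simp add: finite_permutations)
    show "{id, ?t} \<subseteq> ?P" using pqn by (auto simp: permutes_id permutes_swap_id)
    show "\<forall>u \<in> ?P - {id, ?t}. ?g u = 0"
    proof
      fix u assume u: "u \<in> ?P - {id, ?t}"
      have "\<exists>i<n. i \<noteq> p \<and> i \<noteq> q \<and> u i \<noteq> i"
      proof (rule ccontr)
        assume "\<not> ?thesis"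
        hence fix_: "u i = i" if "i \<noteq> p" "i \<noteq> q" for i
          using u that permutes_not_in[of u "{0..<n}" i] by (cases "i < n") auto
        have inj: "inj u" using u by (auto intro: permutes_inj)
        have "u p \<in> {p, q}" "u q \<in> {p, q}"
          using fix_ injD[OF inj] by (metis insertCI)+
        moreover have "u p \<noteq> u q" using injD[OF inj] pqn by blast
        ultimately consider "u p = p" "u q = q" | "u p = q" "u q = p" by auto
        hence "u = id \<or> u = ?t"
        proof cases
          case 1
          have "u x = x" for x using 1 fix_ by (cases "x = p \<or> x = q") auto
          thus ?thesis by (simp add: fun_eq_iff)
        next
          case 2
          hence "u = ?t" using fix_ by (auto simp: fun_eq_iff transpose_def)
          thus ?thesis ..
        qed
        thus False using u by auto
      qed
      then obtain i where i: "i < n" "i \<noteq> p" "i \<noteq> q" "u i \<noteq> i" by auto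
      have "u i < n" using u i(1) permutes_in_image[of u "{0..<n}" i] by auto
      hence "c i (u i) = 0" using id[of i "u i"] i by auto
      hence "(\<Prod>i = 0..<n. c i (u i)) = 0"
        using i(1) by (intro prod_zero) auto
      thus "?g u = 0" by simp
    qed
  qed
  also have "\<dots> = ?g id + ?g ?t"
    using pqn by (subst sum.insert) (auto simp: fun_eq_iff transpose_def)
  also have "?g id = c p p * c q q"
    using split[of "\<lambda>i. c i (id i)"] id by simp
  also have "?g ?t = - (c p q * c q p)"
  proof -
    have "(\<Prod>i = 0..<n. c i (?t i)) = c p q * c q p"
      using split[of "\<lambda>i. c i (?t i)"] id by (simp add: transpose_def)
    thus ?thesis using pqn by (simp add: sign_swap_id)
  qed
  finally show ?thesis by simp
qed

text \<open>Multiply \<open>B\<close> from the left by the identity matrix with the rows \<open>p\<close> and \<open>q\<close> replaced by those of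
  the adjugate.\<close>

lemma desnanot_jacobi_nonsingular:
  fixes B :: "nat \<Rightarrow> nat \<Rightarrow> 'a :: idom"
  assumes pq: "p < q" "q < n" and nz: "fdet n B \<noteq> 0"
  shows "fdet n B * fdet (n - 2) (minor_fun p p (minor_fun q q B)) =
    fdet (n - 1) (minor_fun p p B) * fdet (n - 1) (minor_fun q q B) -
    fdet (n - 1) (minor_fun p q B) * fdet (n - 1) (minor_fun q p B)"
proof -
  define A where "A = mat n n (\<lambda>(i, j). B i j)"
  have A: "A \<in> carrier_mat n n" by (simp add: A_def)
  have dA: "det A = fdet n B" by (simp add: A_def fdet_def)
  define c where "c = (\<lambda>i j. if i = p \<or> i = q then adj_mat A $$ (i, j) else if i = j then 1 else 0)"
  \<comment> \<open>The product of \<open>c\<close> and \<open>B\<close>: the adjugate times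
    \<open>A\<close> is scalar, so rows \<open>p\<close> and \<open>q\<close> become multiples of
    unit vectors.\<close>
  define d where "d = (\<lambda>i j. if i = p \<or> i = q then (if i = j then fdet n B else 0) else B i j)"
  have adjA: "(adj_mat A * A) $$ (i, j) = (if i = j then fdet n B else 0)" if "i < n" "j < n" for i j
    unfolding adj_mat(3)[OF A] dA using that by simp
  have adj: "adj_mat A $$ (i, j) = (-1) ^ (i + j) * fdet (n - 1) (minor_fun j i B)" if "i < n" "j < n" for i j
    using that by (simp add: adj_mat_def cofactor_def A_def fdet_delete add.commute)
  have "mat n n (\<lambda>(i, j). c i j) * A = mat n n (\<lambda>(i, j). d i j)"
  proof (rule eq_matI)
    fix i j assume "i < dim_row (mat n n (\<lambda>(i, j). d i j))" "j < dim_col (mat n n (\<lambda>(i, j). d i j))"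
    hence ij: "i < n" "j < n" by auto
    have "(mat n n (\<lambda>(i, j). c i j) * A) $$ (i, j) = (\<Sum>k = 0..<n. c i k * A $$ (k, j))"
      using ij A by (auto simp: scalar_prod_def)
    also have "\<dots> = d i j"
    proof (cases "i = p \<or> i = q")
      case True
      have "(\<Sum>k = 0..<n. c i k * A $$ (k, j)) = (adj_mat A * A) $$ (i, j)"
        using ij A adj_mat(1)[OF A] True by (auto simp: scalar_prod_def c_def)
      thus ?thesis using True ij adjA by (auto simp: d_def)
    next
      case False
      have "(\<Sum>k = 0..<n. c i k * A $$ (k, j)) = (\<Sum>k = 0..<n. if k = i then A $$ (i, j) else 0)"
        by (rule sum.cong) (use False in \<open>auto simp: c_def\<close>)
      thus ?thesis using False ij by (simp add: d_def A_def)
    qed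
    finally show "(mat n n (\<lambda>(i, j). c i j) * A) $$ (i, j) = mat n n (\<lambda>(i, j). d i j) $$ (i, j)"
      using ij by simp
  qed (use A in auto)
  hence "fdet n c * fdet n B = fdet n d"
    unfolding fdet_def A_def[symmetric] using det_mult[of "mat n n (\<lambda>(i, j). c i j)" n A] A by simp
  moreover have "fdet n c = c p p * c q q - c p q * c q p"
    by (rule fdet_two_rows[OF pq]) (auto simp: c_def)
  moreover have "c p p * c q q = fdet (n - 1) (minor_fun p p B) * fdet (n - 1) (minor_fun q q B)"
    using pq by (simp add: c_def adj)
  moreover have "c p q * c q p = fdet (n - 1) (minor_fun p q B) * fdet (n - 1) (minor_fun q p B)"
    using pq by (simp add: c_def adj add.commute algebra_simps flip: power_add mult_2)
  moreover have "fdet n d = fdet n B * (fdet n B * fdet (n - 2) (minor_fun p p (minor_fun q q B)))"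
  proof -
    \<comment> \<open>Row \<open>q\<close> is expanded first; since \<open>p < q\<close>, row
      \<open>p\<close> then keeps its index.\<close>
    have "fdet n d = d q q * fdet (n - 1) (minor_fun q q d)"
      by (rule fdet_single_entry_row) (use pq in \<open>auto simp: d_def\<close>)
    also have "fdet (n - 1) (minor_fun q q d) =
        minor_fun q q d p p * fdet (n - 1 - 1) (minor_fun p p (minor_fun q q d))"
      by (rule fdet_single_entry_row)
        (use pq in \<open>auto simp: d_def minor_fun_def insert_index_def\<close>)
    also have "fdet (n - 1 - 1) (minor_fun p p (minor_fun q q d)) =
        fdet (n - 2) (minor_fun p p (minor_fun q q B))"
      unfolding diff_diff_left one_add_one
      by (rule fdet_cong) (use pq in \<open>auto simp: d_def minor_fun_def insert_index_def\<close>)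
    also have "minor_fun q q d p p = fdet n B"
      using pq by (simp add: minor_fun_def d_def)
    also have "d q q = fdet n B" by (simp add: d_def)
    finally show ?thesis by simp
  qed
  ultimately have "fdet n B * (fdet (n - 1) (minor_fun p p B) * fdet (n - 1) (minor_fun q q B) -
      fdet (n - 1) (minor_fun p q B) * fdet (n - 1) (minor_fun q p B)) =
      fdet n B * (fdet n B * fdet (n - 2) (minor_fun p p (minor_fun q q B)))"
    by (simp only: mult.commute)
  thus ?thesis using nz by simp
qed

text \<open>Replacing \<open>B\<close> by \<open>B + X I\<close> over the polynomial ring makes the determinant nonzero, being monic
  in \<open>X\<close>; then evaluate at \<open>X = 0\<close>.\<close>

lemma desnanot_jacobi:
  fixes B :: "nat \<Rightarrow> nat \<Rightarrow> 'a :: idom"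
  assumes pq: "p < q" "q < n"
  shows "fdet n B * fdet (n - 2) (minor_fun p p (minor_fun q q B)) =
    fdet (n - 1) (minor_fun p p B) * fdet (n - 1) (minor_fun q q B) -
    fdet (n - 1) (minor_fun p q B) * fdet (n - 1) (minor_fun q p B)"
proof -
  define P where "P = (\<lambda>i j. [:B i j:] + (if i = j then [:0, 1:] else 0))"
  \<comment> \<open>The sign is there because the characteristic polynomial is the determinant of
    \<open>X I - A\<close>.\<close>
  define A where "A = mat n n (\<lambda>(i, j). - B i j)"
  have A: "A \<in> carrier_mat n n" by (simp add: A_def)
  have "mat n n (\<lambda>(i, j). P i j) = char_poly_matrix A"
    by (rule eq_matI) (auto simp: P_def A_def char_poly_matrix_def)
  hence "fdet n P = char_poly A" by (simp add: fdet_def char_poly_def)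
  hence nz: "fdet n P \<noteq> 0"
    using degree_monic_char_poly[OF A] by auto
  \<comment> \<open>Arbitrary index maps \<open>f\<close> and \<open>g\<close> cover the matrix and
    all its iterated minors at once.\<close>
  have ev: "poly (fdet m (\<lambda>i j. P (f i) (g j))) 0 = fdet m (\<lambda>i j. B (f i) (g j))" for m f g
    unfolding fdet_def by (rule poly_det_cong[of _ m]) (auto simp: P_def)
  show ?thesis
    using arg_cong[OF desnanot_jacobi_nonsingular[OF pq nz], of "\<lambda>r. poly r 0"]
    using ev[of n "\<lambda>i. i" "\<lambda>i. i"]
    by (simp add: minor_fun_def ev)
qed

section \<open>Matrices supported on a staircase region\<close>

text \<open>Being bounded by two staircases, in corner form: an upper right and a lower left corner
  in the region force the rectangle between them. Only the order of indices enters, so deletions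
  preserve it.\<close>

definition staircase :: "nat \<Rightarrow> (nat \<Rightarrow> nat \<Rightarrow> bool) \<Rightarrow> bool" where
  "staircase n S \<longleftrightarrow> (\<forall>i1 i2 j1 j2 i j. S i1 j1 \<and> S i2 j2 \<and> i1 \<le> i \<and> i \<le> i2 \<and> i2 < n \<and>
     j2 \<le> j \<and> j \<le> j1 \<and> j1 < n \<longrightarrow> S i j)"

text \<open>No \<open>3 \<times> 3\<close> minor is full except for the missing opposite corners \<open>(a, b)\<close> and \<open>(c, d)\<close>. (If \<open>S\<close>
  is a staircase, the remaining three entries are automatically full.)\<close>

definition corner_free :: "nat \<Rightarrow> (nat \<Rightarrow> nat \<Rightarrow> bool) \<Rightarrow> bool" where
  "corner_free n S \<longleftrightarrow> (\<forall>a x c d y b. a < x \<and> x < c \<and> c < n \<and> d < y \<and> y < b \<and> b < n \<and>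
     S a y \<and> S x b \<and> S x d \<and> S c y \<longrightarrow> S a b \<or> S c d)"

definition pairs :: "nat \<Rightarrow> (nat \<times> nat) set" where
  "pairs n = {(i, j). i < j \<and> j < n}"

definition full_pairs :: "nat \<Rightarrow> (nat \<Rightarrow> nat \<Rightarrow> bool) \<Rightarrow> (nat \<times> nat) set" where
  "full_pairs n S = {(i, j). i < j \<and> j < n \<and> S i j \<and> S j i}"

text \<open>This is meant for a matrix whose columns are already reversed: reversing
  \<open>m\<close> columns has sign \<open>(-1) ^ card (pairs m)\<close>, so the minors before the
  reversal are positive.\<close>

definition full_minors_pos :: "nat \<Rightarrow> (nat \<Rightarrow> nat \<Rightarrow> bool) \<Rightarrow> (nat \<Rightarrow> nat \<Rightarrow> real) \<Rightarrow> bool" where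
  "full_minors_pos n S M \<longleftrightarrow> (\<forall>m f g. strict_mono_on {..<m} f \<and> strict_mono_on {..<m} g \<and>
     f ` {..<m} \<subseteq> {..<n} \<and> g ` {..<m} \<subseteq> {..<n} \<and> (\<forall>i<m. \<forall>j<m. S (f i) (g j)) \<longrightarrow>
     0 < (-1) ^ card (pairs m) * fdet m (\<lambda>i j. M (f i) (g j)))"

definition restrict_fun :: "(nat \<Rightarrow> nat \<Rightarrow> bool) \<Rightarrow> (nat \<Rightarrow> nat \<Rightarrow> real) \<Rightarrow> nat \<Rightarrow> nat \<Rightarrow> real" where
  "restrict_fun S M i j = (if S i j then M i j else 0)"

section \<open>Region conditions under deletion of a row and a column\<close>

lemma staircaseD:
  assumes "staircase n S" "S i1 j1" "S i2 j2" "i1 \<le> i" "i \<le> i2" "i2 < n" "j2 \<le> j" "j \<le> j1" "j1 < n"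
  shows "S i j"
  using assms unfolding staircase_def by blast

lemma corner_freeD:
  assumes "corner_free n S" "a < x" "x < c" "c < n" "d < y" "y < b" "b < n"
    "S a y" "S x b" "S x d" "S c y"
  shows "S a b \<or> S c d"
  using assms unfolding corner_free_def by blast

lemma finite_pairs_below: "finite (pairs n)"
  unfolding pairs_def by (rule finite_pairs)

lemma full_pairs_subset: "full_pairs n S \<subseteq> pairs n"
  by (auto simp: full_pairs_def pairs_def)

lemma finite_full_pairs: "finite (full_pairs n S)"
  by (rule finite_subset[OF full_pairs_subset finite_pairs_below])

lemma insert_index_le_iff: "insert_index p i \<le> insert_index p j \<longleftrightarrow> i \<le> j"
  and insert_index_less_iff: "insert_index p i < insert_index p j \<longleftrightarrow> i < j"
  by (auto simp: insert_index_def)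

lemma minor_restrict_fun:
  "minor_fun p q (restrict_fun S M) = restrict_fun (minor_fun p q S) (minor_fun p q M)"
  by (simp add: fun_eq_iff minor_fun_def restrict_fun_def)

lemma staircase_minor:
  assumes "staircase n S"
  shows "staircase (n - 1) (minor_fun p q S)"
  unfolding staircase_def minor_fun_def
  by (intro allI impI, elim conjE, rule staircaseD[OF assms], assumption+)
     (simp_all add: insert_index_le_iff insert_index_less)

lemma corner_free_minor:
  assumes "corner_free n S"
  shows "corner_free (n - 1) (minor_fun p q S)"
  unfolding corner_free_def minor_fun_def
proof (intro allI impI, elim conjE)
  fix a x c d y b :: nat
  let ?p = "insert_index p" and ?q = "insert_index q"
  assume "a < x" "x < c" "c < n - 1" "d < y" "y < b" "b < n - 1"
    and "S (?p a) (?q y)" "S (?p x) (?q b)" "S (?p x) (?q d)" "S (?p c) (?q y)"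
  thus "S (?p a) (?q b) \<or> S (?p c) (?q d)"
    by (intro corner_freeD[OF assms, of _ "?p x" _ _ "?q y"])
       (simp_all add: insert_index_less_iff insert_index_less)
qed

lemma full_minors_pos_minor:
  assumes "full_minors_pos n S M"
  shows "full_minors_pos (n - 1) (minor_fun p q S) (minor_fun p q M)"
  unfolding full_minors_pos_def
proof (intro allI impI, elim conjE)
  fix m :: nat and f g :: "nat \<Rightarrow> nat"
  assume *: "strict_mono_on {..<m} f" "strict_mono_on {..<m} g" "f ` {..<m} \<subseteq> {..<n - 1}"
    "g ` {..<m} \<subseteq> {..<n - 1}" "\<forall>i<m. \<forall>j<m. minor_fun p q S (f i) (g j)"
  have "strict_mono_on {..<m} (insert_index r \<circ> h)" if "strict_mono_on {..<m} h" for r h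
    using that by (auto simp: strict_mono_on_def insert_index_less_iff)
  moreover have "(insert_index r \<circ> h) ` {..<m} \<subseteq> {..<n}" if "h ` {..<m} \<subseteq> {..<n - 1}" for r h
    using that by (auto intro!: insert_index_less)
  ultimately show "0 < (-1) ^ card (pairs m) * fdet m (\<lambda>i j. minor_fun p q M (f i) (g j))"
    using assms[unfolded full_minors_pos_def, rule_format,
        of m "insert_index p \<circ> f" "insert_index q \<circ> g"] *
    by (simp add: minor_fun_def)
qed

text \<open>Pigeonhole: the \<open>i + 1\<close> indices up to \<open>i\<close> do not fit into the
  \<open>i\<close> values below \<open>i\<close>, and similarly from above.\<close>

lemma permutes_ex_le_ge:
  fixes n :: nat
  assumes u: "u permutes {0..<n}" and i: "i < n"
  shows "\<exists>a\<le>i. i \<le> u a" and "\<exists>b<n. i \<le> b \<and> u b \<le> i"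
proof -
  have inj: "inj_on u A" for A using permutes_inj[OF u] by (rule inj_on_subset) simp
  show "\<exists>a\<le>i. i \<le> u a"
  proof (rule ccontr)
    assume *: "\<not> ?thesis"
    have "u a < i" if "a \<le> i" for a
      by (rule ccontr) (use * that in \<open>simp add: not_less\<close>)
    hence "u ` {..i} \<subseteq> {..<i}" by auto
    from card_mono[OF _ this] show False by (simp add: card_image[OF inj])
  qed
  show "\<exists>b<n. i \<le> b \<and> u b \<le> i"
  proof (rule ccontr)
    assume *: "\<not> ?thesis"
    have "i < u b" if "i \<le> b" "b < n" for b
      by (rule ccontr) (use * that in \<open>fastforce simp: not_less\<close>)
    moreover have "u b < n" if "b < n" for b using that permutes_in_image[OF u, of b] by simp
    ultimately have "u ` {i..<n} \<subseteq> {Suc i..<n}" by (auto simp: Suc_le_eq)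
    from card_mono[OF _ this] show False using i by (simp add: card_image[OF inj])
  qed
qed

text \<open>Some dot of \<open>u\<close> lies weakly above and right of \<open>(i, i)\<close> and
  some dot weakly below and left; the rectangle they span contains the diagonal cell.\<close>

lemma staircase_diag:
  assumes S: "staircase n S" and u: "u permutes {0..<n}" and us: "\<And>i. i < n \<Longrightarrow> S i (u i)" and i: "i < n"
  shows "S i i"
proof -
  obtain a b where ab: "a \<le> i" "i \<le> u a" "b < n" "i \<le> b" "u b \<le> i"
    using permutes_ex_le_ge[OF u i] by blast
  show ?thesis
    by (rule staircaseD[OF S us[of a] us[of b]])
       (use ab i permutes_in_image[OF u, of a] in auto)
qed

text \<open>By \<open>staircase_diag\<close> every permutation leaves a region with a missing
  diagonal cell, so every Leibniz term has a zero factor.\<close>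

lemma fdet_restrict_eq_0:
  assumes S: "staircase n S" and i: "i < n" "\<not> S i i"
  shows "fdet n (restrict_fun S M) = 0"
  unfolding fdet_leibniz
proof (rule sum.neutral, rule ballI)
  fix u assume "u \<in> {u. u permutes {0..<n}}"
  hence u: "u permutes {0..<n}" by simp
  obtain j where "j < n" "\<not> S j (u j)" using staircase_diag[OF S u] i by blast
  hence "(\<Prod>i = 0..<n. restrict_fun S M i (u i)) = 0"
    by (intro prod_zero) (auto simp: restrict_fun_def intro!: bexI[of _ j])
  thus "signof u * (\<Prod>i = 0..<n. restrict_fun S M i (u i)) = 0" by simp
qed

lemma card_full_pairs_minor:
  assumes "p < n"
  shows "card (full_pairs (n - 1) (minor_fun p p S)) =
    card {(i, j) \<in> full_pairs n S. i \<noteq> p \<and> j \<noteq> p}"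
proof -
  let ?h = "map_prod (insert_index p) (insert_index p)"
  have "{(i, j) \<in> full_pairs n S. i \<noteq> p \<and> j \<noteq> p} = ?h ` full_pairs (n - 1) (minor_fun p p S)"
  proof (intro equalityI subsetI)
    fix z assume "z \<in> {(i, j) \<in> full_pairs n S. i \<noteq> p \<and> j \<noteq> p}"
    then obtain i j where z: "z = (i, j)" "i < j" "j < n" "S i j" "S j i" "i \<noteq> p" "j \<noteq> p"
      by (auto simp: full_pairs_def)
    \<comment> \<open>\<open>?d\<close> inverts \<open>insert_index p\<close> away from
      \<open>p\<close>.\<close>
    let ?d = "\<lambda>i. if i < p then i else i - 1"
    have d: "insert_index p (?d i) = i" "insert_index p (?d j) = j" "?d i < ?d j" "?d j < n - 1"
      using z assms by (auto simp: insert_index_def)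
    have "z = ?h (?d i, ?d j)" unfolding map_prod_simp d(1,2) by (rule z)
    moreover have "(?d i, ?d j) \<in> full_pairs (n - 1) (minor_fun p p S)"
      using d(3,4) z(4,5) unfolding full_pairs_def minor_fun_def mem_Collect_eq case_prod_conv d(1,2)
      by blast
    ultimately show "z \<in> ?h ` full_pairs (n - 1) (minor_fun p p S)" by (rule image_eqI)
  qed (auto simp: full_pairs_def minor_fun_def insert_index_less_iff insert_index_less)
  moreover have "inj_on ?h A" for A
    by (rule inj_on_subset[of _ UNIV]) (auto intro!: prod.inj_map insert_index_inj_on)
  ultimately show ?thesis by (simp add: card_image)
qed

text \<open>The only pair meeting both \<open>p\<close> and \<open>q\<close> is
  \<open>(p, q)\<close>, which is not full. So every full pair survives one of the two deletions,
  and those surviving both are counted by the smallest minor.\<close>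

lemma card_full_pairs_inclusion_exclusion:
  assumes pq: "p < q" "q < n" and nf: "\<not> (S p q \<and> S q p)"
  shows "card (full_pairs n S) + card (full_pairs (n - 2) (minor_fun p p (minor_fun q q S))) =
    card (full_pairs (n - 1) (minor_fun p p S)) + card (full_pairs (n - 1) (minor_fun q q S))"
proof -
  let ?A = "\<lambda>p. {(i, j) \<in> full_pairs n S. i \<noteq> p \<and> j \<noteq> p}"
  have fin: "finite (?A r)" for r by (rule finite_subset[OF _ finite_full_pairs]) auto
  have 1: "?A p \<union> ?A q = full_pairs n S" using pq nf by (auto simp: full_pairs_def)
  let ?h = "map_prod (insert_index q) (insert_index q)"
  let ?B = "{(i, j) \<in> full_pairs (n - 1) (minor_fun q q S). i \<noteq> p \<and> j \<noteq> p}"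
  have "card (full_pairs (n - 2) (minor_fun p p (minor_fun q q S))) = card ?B"
    using card_full_pairs_minor[of p "n - 1" "minor_fun q q S"] pq by (simp add: numeral_2_eq_2)
  also have "\<dots> = card (?A p \<inter> ?A q)"
  proof (rule bij_betw_same_card[of ?h], rule bij_betw_imageI)
    show "inj_on ?h ?B"
      by (rule inj_on_subset[of _ UNIV]) (auto intro!: prod.inj_map insert_index_inj_on)
    show "?h ` ?B = ?A p \<inter> ?A q"
    proof (intro equalityI subsetI)
      fix z assume "z \<in> ?h ` ?B"
      thus "z \<in> ?A p \<inter> ?A q"
        using pq by (auto simp: full_pairs_def minor_fun_def insert_index_less_iff insert_index_less)
           (auto simp: insert_index_def split: if_splits)
    next
      fix z assume "z \<in> ?A p \<inter> ?A q"
      then obtain i j where z: "z = (i, j)" "i < j" "j < n" "S i j" "S j i" "i \<noteq> p" "j \<noteq> p" "i \<noteq> q" "j \<noteq> q"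
        by (auto simp: full_pairs_def)
      let ?d = "\<lambda>i. if i < q then i else i - 1"
      have d: "insert_index q (?d i) = i" "insert_index q (?d j) = j" "?d i < ?d j" "?d j < n - 1"
         "?d i \<noteq> p" "?d j \<noteq> p"
        using z pq by (auto simp: insert_index_def)
      have "z = ?h (?d i, ?d j)" unfolding map_prod_simp d(1,2) by (rule z)
      moreover have "(?d i, ?d j) \<in> ?B"
        using d(3-6) z(4,5) unfolding full_pairs_def minor_fun_def mem_Collect_eq case_prod_conv d(1,2)
        by blast
      ultimately show "z \<in> ?h ` ?B" by (rule image_eqI)
    qed
  qed
  finally show ?thesis
    using card_Un_Int[OF fin fin, of p q] card_full_pairs_minor[of p n S] card_full_pairs_minor[of q n S] pq
    unfolding 1 by simp
qed

lemma card_full_pairs_eq_sum: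
  "card (full_pairs n S) = (\<Sum>(i, j) \<in> pairs n. of_bool (S i j \<and> S j i))"
proof -
  have "full_pairs n S = pairs n \<inter> {z. case z of (i, j) \<Rightarrow> S i j \<and> S j i}"
    by (auto simp: full_pairs_def pairs_def)
  thus ?thesis
    by (simp add: case_prod_beta finite_pairs_below)
qed

text \<open>Term by term, the full pairs of the two principal minors match those of the two other
  ones, except for the index pair \<open>(p, q - 1)\<close>, whose term involves the missing corner
  \<open>(p, q)\<close> or \<open>(q, p)\<close>.\<close>

lemma card_full_pairs_minors:
  assumes S: "staircase n S" and C: "corner_free n S" and diag: "\<And>i. i < n \<Longrightarrow> S i i"
    and pq: "Suc p < q" "q < n" and nf: "\<not> (S p q \<and> S q p)"
    and near: "\<And>x y. x < n \<Longrightarrow> y < n \<Longrightarrow> x < y + (q - p) \<Longrightarrow> y < x + (q - p) \<Longrightarrow> S x y"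
  shows "card (full_pairs (n - 1) (minor_fun p p S)) + card (full_pairs (n - 1) (minor_fun q q S)) =
    card (full_pairs (n - 1) (minor_fun p q S)) + card (full_pairs (n - 1) (minor_fun q p S)) + 1"
proof -
  let ?T = "\<lambda>r s (i, j). of_bool (minor_fun r s S i j \<and> minor_fun r s S j i) :: nat"
  \<comment> \<open>Corner-freeness with middle index \<open>Suc p\<close>; together with
    \<open>nf\<close>, exactly one of the two corners is present.\<close>
  have one: "S p q \<or> S q p"
    by (rule corner_freeD[OF C, of p "Suc p" q p "Suc p" q]) (use pq in \<open>auto intro: near\<close>)
  have termwise: "?T p p (i, j) + ?T q q (i, j) =
      ?T p q (i, j) + ?T q p (i, j) + of_bool ((i, j) = (p, q - 1))"
    if ij: "i < j" "j < n - 1" for i j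
  proof -
    \<comment> \<open>\<open>insert_index p\<close> and \<open>insert_index q\<close> differ exactly
      on the block from \<open>p\<close> to \<open>q - 1\<close>; the cases record which of
      \<open>i\<close> and \<open>j\<close> lie in it.\<close>
    consider "(i < p \<or> q \<le> i) \<and> (j < p \<or> q \<le> j)" | "p \<le> i" "j < q"
      | "i < p" "p \<le> j" "j < q" | "p \<le> i" "i < q" "q \<le> j"
      using ij by linarith
    thus ?thesis
    proof cases
      case 1
      hence "insert_index p i = insert_index q i" "insert_index p j = insert_index q j"
        and "(i, j) \<noteq> (p, q - 1)"
        using ij pq by (auto simp: insert_index_def)
      thus ?thesis by (simp add: minor_fun_def)
    next
      case 2
      have a: "S (Suc i) (Suc j)" "S (Suc j) (Suc i)" "S i j" "S j i" "S (Suc i) j" "S j (Suc i)"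
        using 2 ij pq by (auto intro!: near)
      have ins: "insert_index p i = Suc i" "insert_index p j = Suc j"
        "insert_index q i = i" "insert_index q j = j"
        using 2 ij by auto
      show ?thesis
      proof (cases "(i, j) = (p, q - 1)")
        case True
        \<comment> \<open>Both terms on the left are 1. On the right exactly one of the first two is
          1, and the indicator adds the other unit.\<close>
        hence e: "S i (Suc j) = S p q" "S (Suc j) i = S q p" using pq by auto
        show ?thesis unfolding minor_fun_def case_prod_conv ins e using a True one nf by auto
      next
        case False
        hence "S (Suc j) i" "S i (Suc j)" using 2 ij pq by (auto intro!: near)
        thus ?thesis unfolding minor_fun_def case_prod_conv ins using a False by simp
      qed
    next
      case 3
      \<comment> \<open>The two sides differ only if \<open>S i j\<close> and \<open>S j i\<close>
        hold while \<open>S i (Suc j)\<close> and \<open>S (Suc j) i\<close> both fail. By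
        \<open>m1\<close> and \<open>m2\<close> membership can only be lost when \<open>j\<close>
        grows, and \<open>m3\<close> excludes losing both at once.\<close>
      have m1: "S i (Suc j) \<Longrightarrow> S i j"
        by (rule staircaseD[OF S, of i "Suc j" j j]) (use 3 ij pq diag in auto)
      have m2: "S (Suc j) i \<Longrightarrow> S j i"
        by (rule staircaseD[OF S, of j j "Suc j" i]) (use 3 ij pq diag in auto)
      have m3: "S i j \<Longrightarrow> S j i \<Longrightarrow> S i (Suc j) \<or> S (Suc j) i"
        by (rule corner_freeD[OF C, of i j "Suc j" i j "Suc j"])
          (use 3 ij pq in \<open>auto intro!: near\<close>)
      have ins: "insert_index p i = i" "insert_index p j = Suc j"
        "insert_index q i = i" "insert_index q j = j" "(i, j) \<noteq> (p, q - 1)"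
        using 3 ij by auto
      show ?thesis unfolding minor_fun_def case_prod_conv ins(1-4) using ins(5) m1 m2 m3
        by (cases "S i (Suc j)"; cases "S (Suc j) i"; cases "S i j"; cases "S j i")
          (simp_all del: prod.inject)
    next
      case 4
      have m1: "S i (Suc j) \<Longrightarrow> S (Suc i) (Suc j)"
        by (rule staircaseD[OF S, of i "Suc j" "Suc i" "Suc i"]) (use 4 ij pq diag in auto)
      have m2: "S (Suc j) i \<Longrightarrow> S (Suc j) (Suc i)"
        by (rule staircaseD[OF S, of "Suc i" "Suc i" "Suc j" i]) (use 4 ij pq diag in auto)
      have m3: "S (Suc i) (Suc j) \<Longrightarrow> S (Suc j) (Suc i) \<Longrightarrow> S i (Suc j) \<or> S (Suc j) i"
        by (rule corner_freeD[OF C, of i "Suc i" "Suc j" i "Suc i" "Suc j"])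
          (use 4 ij pq in \<open>auto intro!: near\<close>)
      have ins: "insert_index p i = Suc i" "insert_index p j = Suc j"
        "insert_index q i = i" "insert_index q j = Suc j" "(i, j) \<noteq> (p, q - 1)"
        using 4 ij by auto
      show ?thesis unfolding minor_fun_def case_prod_conv ins(1-4) using ins(5) m1 m2 m3
        by (cases "S i (Suc j)"; cases "S (Suc j) i"; cases "S (Suc i) (Suc j)"; cases "S (Suc j) (Suc i)")
          (simp_all del: prod.inject)
    qed
  qed
  have "(\<Sum>z \<in> pairs (n - 1). ?T p p z + ?T q q z) =
      (\<Sum>z \<in> pairs (n - 1). ?T p q z + ?T q p z + of_bool (z = (p, q - 1)))"
  proof (rule sum.cong[OF refl])
    fix z assume "z \<in> pairs (n - 1)"
    thus "?T p p z + ?T q q z = ?T p q z + ?T q p z + of_bool (z = (p, q - 1))"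
      using termwise by (cases z) (auto simp: pairs_def)
  qed
  moreover have "(\<Sum>z \<in> pairs (n - 1). of_bool (z = (p, q - 1)) :: nat) = 1"
  proof -
    have "(p, q - 1) \<in> pairs (n - 1)"
      using pq by (auto simp: pairs_def)
    thus ?thesis by (simp add: of_bool_def finite_pairs_below)
  qed
  ultimately show ?thesis by (simp add: card_full_pairs_eq_sum sum.distrib)
qed

text \<open>Apply the Desnanot--Jacobi identity to a pair \<open>p < q\<close> that is not full, with \<open>q - p\<close> minimal. If
  \<open>q = p + 1\<close>, one of the two off-diagonal minors vanishes; otherwise all four have a full diagonal.\<close>

lemma fdet_restrict_sign:
  assumes "staircase n S" "corner_free n S" "full_minors_pos n S M" "\<And>i. i < n \<Longrightarrow> S i i"
  shows "0 < (-1) ^ card (full_pairs n S) * fdet n (restrict_fun S M)"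
  using assms
proof (induction n arbitrary: S M rule: less_induct)
  case (less n)
  note S = less.prems(1) and C = less.prems(2) and M = less.prems(3) and diag = less.prems(4)
  show ?case
  proof (cases "\<forall>p q. p < q \<and> q < n \<longrightarrow> S p q \<and> S q p")
    case True
    hence all: "S i j" if "i < n" "j < n" for i j
      using that diag by (cases i j rule: linorder_cases) auto
    have "full_pairs n S = pairs n" using all by (auto simp: full_pairs_def pairs_def)
    moreover have "fdet n (restrict_fun S M) = fdet n M"
      by (rule fdet_cong) (auto simp: restrict_fun_def all)
    moreover have "0 < (-1) ^ card (pairs n) * fdet n M"
      using M[unfolded full_minors_pos_def, rule_format, of n "\<lambda>i. i" "\<lambda>i. i"] all
      by (auto simp: strict_mono_on_def)
    ultimately show ?thesis by simp
  next
    case False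
    define bad where "bad d \<longleftrightarrow> (\<exists>p q. p < q \<and> q < n \<and> \<not> (S p q \<and> S q p) \<and> q - p = d)" for d
    have "\<exists>d. bad d" using False by (auto simp: bad_def)
    hence bd: "bad (Least bad)" by (rule LeastI_ex)
    then obtain p q where pq: "p < q" "q < n" and nf: "\<not> (S p q \<and> S q p)" and d: "q - p = Least bad"
      unfolding bad_def by blast
    \<comment> \<open>Minimality of \<open>q - p\<close> fills the band around the diagonal.\<close>
    have near: "S x y" if xy: "x < n" "y < n" "x < y + (q - p)" "y < x + (q - p)" for x y
    proof -
      have "\<not> bad d'" if "d' < q - p" for d' using that not_less_Least d by metis
      hence *: "S x y \<and> S y x" if "x < y" "y < n" "y - x < q - p" for x y
        using that unfolding bad_def by blast
      show ?thesis using *[of x y] *[of y x] diag xy by (cases x y rule: linorder_cases) auto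
    qed
    let ?D = "\<lambda>m S M. fdet m (restrict_fun S M)"
    let ?f = "\<lambda>r s. card (full_pairs (n - 1) (minor_fun r s S))"
    let ?E = "\<lambda>r s. fdet (n - 1) (minor_fun r s (restrict_fun S M))"
    have IH: "0 < (-1) ^ ?f r s * ?E r s" if "\<And>i. i < n - 1 \<Longrightarrow> minor_fun r s S i i" for r s
      unfolding minor_restrict_fun
      by (rule less.IH) (use pq that in \<open>auto intro!: staircase_minor corner_free_minor full_minors_pos_minor S C M
           simp del: One_nat_def\<close>)
    let ?X = "fdet (n - 2) (minor_fun p p (minor_fun q q (restrict_fun S M)))"
    let ?x = "card (full_pairs (n - 2) (minor_fun p p (minor_fun q q S)))"
    have X: "0 < (-1) ^ ?x * ?X"
      unfolding minor_restrict_fun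
    proof (rule less.IH)
      show "staircase (n - 2) (minor_fun p p (minor_fun q q S))"
        using staircase_minor[OF staircase_minor[OF S], of p p q q] by (simp add: numeral_2_eq_2)
      show "corner_free (n - 2) (minor_fun p p (minor_fun q q S))"
        using corner_free_minor[OF corner_free_minor[OF C], of p p q q] by (simp add: numeral_2_eq_2)
      show "full_minors_pos (n - 2) (minor_fun p p (minor_fun q q S)) (minor_fun p p (minor_fun q q M))"
        using full_minors_pos_minor[OF full_minors_pos_minor[OF M], of p p q q] by (simp add: numeral_2_eq_2)
    qed (use pq in \<open>auto simp: minor_fun_def insert_index_def intro!: diag\<close>)
    have P: "0 < (-1) ^ ?f p p * ?E p p" "0 < (-1) ^ ?f q q * ?E q q"
      by (rule IH; use pq in \<open>auto simp: minor_fun_def insert_index_def intro!: diag\<close>)+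
    \<comment> \<open>Measured against the sign of the principal product, the other product is not
      positive, so subtracting it cannot cause cancellation.\<close>
    have off: "(-1) ^ (?f p p + ?f q q) * (?E p q * ?E q p) \<le> 0"
    proof (cases "q = Suc p")
      case True
      \<comment> \<open>Since \<open>q = Suc p\<close>, the cell at \<open>(p, p)\<close> of these
        two minors is \<open>(q, p)\<close> and \<open>(p, q)\<close> respectively, and one of those
        is missing.\<close>
      have z: "?E r s = 0" if "\<not> minor_fun r s S p p" for r s
        unfolding minor_restrict_fun
        by (rule fdet_restrict_eq_0[of _ _ p]) (use that pq in \<open>auto intro!: staircase_minor S simp del: One_nat_def\<close>)
      have "?E p q * ?E q p = 0"
        using z[of p q] z[of q p] nf True by (auto simp: minor_fun_def insert_index_def)
      thus ?thesis by (simp only: mult_zero_right order.refl)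
    next
      case False
      hence pq': "Suc p < q" using pq by simp
      have "0 < (-1) ^ ?f p q * ?E p q" "0 < (-1) ^ ?f q p * ?E q p"
        by (rule IH; use pq pq' in \<open>auto simp: minor_fun_def insert_index_def intro!: near\<close>)+
      from mult_pos_pos[OF this] have "0 < (-1) ^ (?f p q + ?f q p) * (?E p q * ?E q p)"
        by (simp add: power_add mult_ac)
      \<comment> \<open>The exponents differ by one, which flips the sign.\<close>
      moreover have "?f p p + ?f q q = ?f p q + ?f q p + 1"
        by (rule card_full_pairs_minors[OF S C diag pq' pq(2) nf near])
      ultimately show ?thesis by simp
    qed
    have "0 < (-1) ^ (?f p p + ?f q q) * (?E p p * ?E q q)"
      using mult_pos_pos[OF P] by (simp add: power_add mult_ac)
    with off have "0 < (-1) ^ (?f p p + ?f q q) * (?D n S M * ?X)"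
      unfolding desnanot_jacobi[OF pq] by (simp add: right_diff_distrib)
    also have "?f p p + ?f q q = card (full_pairs n S) + ?x"
      using card_full_pairs_inclusion_exclusion[OF pq nf] by simp
    finally have "0 < ((-1) ^ card (full_pairs n S) * ?D n S M) * ((-1) ^ ?x * ?X)"
      by (simp add: power_add mult_ac)
    thus ?thesis using X by (simp add: zero_less_mult_iff)
  qed
qed

section \<open>The region of a permutation\<close>

definition dot_region :: "nat \<Rightarrow> (nat \<Rightarrow> nat) \<Rightarrow> nat \<Rightarrow> nat \<Rightarrow> bool" where
  "dot_region n w i j \<longleftrightarrow> (\<exists>a b. a \<le> i \<and> i \<le> b \<and> b < n \<and> w b \<le> j \<and> j \<le> w a)"

lemma dot_regionI: "a \<le> i \<Longrightarrow> i \<le> b \<Longrightarrow> b < n \<Longrightarrow> w b \<le> j \<Longrightarrow> j \<le> w a \<Longrightarrow> dot_region n w i j"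
  by (auto simp: dot_region_def)

lemma staircase_dot_region: "staircase n (dot_region n w)"
  unfolding staircase_def
proof (intro allI impI, elim conjE)
  fix i1 i2 j1 j2 i j
  assume "dot_region n w i1 j1" "dot_region n w i2 j2" and *: "i1 \<le> i" "i \<le> i2" "j2 \<le> j" "j \<le> j1"
  then obtain a b where "a \<le> i1" "j1 \<le> w a" "i2 \<le> b" "b < n" "w b \<le> j2"
    by (auto simp: dot_region_def)
  thus "dot_region n w i j" using * by (intro dot_regionI[of a i b]) auto
qed

lemma dot_region_diag:
  assumes "w permutes {..<n}" "i < n"
  shows "dot_region n w i i"
  using permutes_ex_le_ge[of w n i] assms by (auto simp: dot_region_def atLeast0LessThan)

text \<open>The forbidden pattern is \<open>3412\<close>: \<open>p1\<close> and \<open>p2\<close> witness that \<open>(a, y)\<close> and \<open>(x, b)\<close> lie in the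
  region, \<open>q1\<close> and \<open>q2\<close> do so for \<open>(x, d)\<close> and \<open>(c, y)\<close>.\<close>

lemma corner_free_dot_region:
  assumes av: "\<And>p1 p2 q1 q2. p1 < p2 \<Longrightarrow> p2 < q1 \<Longrightarrow> q1 < q2 \<Longrightarrow> q2 < n \<Longrightarrow>
    w q1 < w q2 \<Longrightarrow> w q2 < w p1 \<Longrightarrow> w p1 < w p2 \<Longrightarrow> False"
    and w: "w permutes {..<n}"
  shows "corner_free n (dot_region n w)"
  unfolding corner_free_def
proof (intro allI impI, elim conjE, rule ccontr)
  fix a x c d y b :: nat
  assume o: "a < x" "x < c" "c < n" "d < y" "y < b" "b < n"
    and S: "dot_region n w a y" "dot_region n w x b" "dot_region n w x d" "dot_region n w c y"
    and N: "\<not> (dot_region n w a b \<or> dot_region n w c d)"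
  from S(1) obtain p1 e where 1: "p1 \<le> a" "y \<le> w p1" "a \<le> e" "e < n" "w e \<le> y" by (auto simp: dot_region_def)
  from S(2) obtain p2 where 2: "p2 \<le> x" "b \<le> w p2" by (auto simp: dot_region_def)
  from S(3) obtain q1 where 3: "x \<le> q1" "q1 < n" "w q1 \<le> d" by (auto simp: dot_region_def)
  from S(4) obtain q2 e' where 4: "c \<le> q2" "q2 < n" "w q2 \<le> y" "e' \<le> c" "y \<le> w e'" by (auto simp: dot_region_def)
  \<comment> \<open>A dot violating \<open>low\<close> or \<open>high\<close> would put the missing
    corner \<open>(a, b)\<close> or \<open>(c, d)\<close> into the region. These bounds force the
    four witnesses into the order needed for \<open>3412\<close>.\<close>
  have low: "w r < b" if "r \<le> a" for r
    using N dot_regionI[of r a e n w b] that 1 o by (meson leI le_trans less_imp_le)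
  have high: "d < w r" if "c \<le> r" "r < n" for r
    using N dot_regionI[of e' c r n w d] that 4 o by (meson leI le_trans less_imp_le)
  have "a < p2" using low[of p2] 2 by (meson leI not_le)
  moreover have "q1 < c" using high[of q1] 3 by (meson leI not_le)
  moreover have "p2 \<noteq> q1" using 2 3 o by auto
  moreover have "w q2 \<noteq> w p1"
    using injD[OF permutes_inj[OF w], of q2 p1] 1 4 o by auto
  ultimately show False
    using av[of p1 p2 q1 q2] low[of p1] high[of q2] 1 2 3 4 o by simp
qed

section \<open>Inversions and full pairs when the entry 0 is deleted\<close>

abbreviation pinv :: "(nat \<Rightarrow> nat) \<Rightarrow> nat \<Rightarrow> nat" where
  "pinv \<equiv> inv_into UNIV"

definition inversions :: "nat \<Rightarrow> (nat \<Rightarrow> nat) \<Rightarrow> (nat \<times> nat) set" where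
  "inversions n w = {(i, j). i < j \<and> j < n \<and> w j < w i}"

lemma finite_inversions: "finite (inversions n w)"
  unfolding inversions_def by (rule finite_subset[OF _ finite_pairs[of n]]) auto

text \<open>One-line notation with the entry 0 removed and the other values lowered by 1, extended
  by the identity so that it permutes \<open>{..<n - 1}\<close>.\<close>

definition delete_dot :: "nat \<Rightarrow> (nat \<Rightarrow> nat) \<Rightarrow> nat \<Rightarrow> nat" where
  "delete_dot n w i = (if i < n - 1 then w (insert_index (pinv w 0) i) - 1 else i)"

context
  fixes n :: nat and w :: "nat \<Rightarrow> nat" and r :: nat
  assumes w: "w permutes {..<n}" and n: "0 < n" and r_def: "r = pinv w 0"
begin

lemma w_r: "w r = 0"
  unfolding r_def using permutes_inverses(1)[OF w] .

lemma r_less: "r < n"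
  using permutes_in_image[OF w, of r] n w_r by simp

lemma w_pos: "i \<noteq> r \<Longrightarrow> 0 < w i"
  using injD[OF permutes_inj[OF w], of i r] w_r by (cases "w i") auto

lemma w_insert_index: "i < n - 1 \<Longrightarrow> w (insert_index r i) = Suc (delete_dot n w i)"
  using w_pos[of "insert_index r i"] by (simp add: delete_dot_def r_def)

lemma delete_dot_permutes: "delete_dot n w permutes {..<n - 1}"
proof (rule bij_imp_permutes)
  have inj: "inj_on (delete_dot n w) {..<n - 1}"
  proof (rule inj_onI)
    fix i j assume "i \<in> {..<n - 1}" "j \<in> {..<n - 1}" "delete_dot n w i = delete_dot n w j"
    hence "w (insert_index r i) = w (insert_index r j)" by (simp add: w_insert_index)
    hence "insert_index r i = insert_index r j" using injD[OF permutes_inj[OF w]] by blast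
    thus "i = j" using insert_index_inj_on[of r UNIV] by (auto dest: injD)
  qed
  have "delete_dot n w ` {..<n - 1} \<subseteq> {..<n - 1}"
  proof (intro subsetI, elim imageE)
    fix y i assume i: "i \<in> {..<n - 1}" and y: "y = delete_dot n w i"
    have "w (insert_index r i) < n"
      using permutes_in_image[OF w, of "insert_index r i"] insert_index_less[of i n r] i by simp
    thus "y \<in> {..<n - 1}" using i y by (simp add: w_insert_index)
  qed
  with inj show "bij_betw (delete_dot n w) {..<n - 1} {..<n - 1}"
    by (simp add: bij_betw_def endo_inj_surj)
qed (auto simp: delete_dot_def)

text \<open>The entry 0 at position \<open>r\<close> is inverted with exactly the \<open>r\<close>
  positions before it; all other inversions are only relabelled.\<close>

lemma card_inversions_delete_dot:
  "card (inversions n w) = card (inversions (n - 1) (delete_dot n w)) + r"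
proof -
  let ?h = "map_prod (insert_index r) (insert_index r)"
  let ?A = "?h ` inversions (n - 1) (delete_dot n w)" and ?B = "(\<lambda>i. (i, r)) ` {..<r}"
  have "inversions n w = ?A \<union> ?B"
  proof (intro equalityI subsetI)
    fix z assume "z \<in> inversions n w"
    then obtain i j where z: "z = (i, j)" "i < j" "j < n" "w j < w i" by (auto simp: inversions_def)
    have ir: "i \<noteq> r" using z(4) w_r by auto
    show "z \<in> ?A \<union> ?B"
    proof (cases "j = r")
      case True
      thus ?thesis using z by auto
    next
      case False
      let ?d = "\<lambda>i. if i < r then i else i - 1"
      have d: "insert_index r (?d i) = i" "insert_index r (?d j) = j" "?d i < ?d j" "?d j < n - 1"
        using z r_less False ir by (auto simp: insert_index_def)
      have "delete_dot n w (?d j) < delete_dot n w (?d i)"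
        using z(4) w_insert_index[of "?d i"] w_insert_index[of "?d j"] d by simp
      hence "(?d i, ?d j) \<in> inversions (n - 1) (delete_dot n w)"
        using d(3,4) by (simp add: inversions_def)
      moreover have "z = ?h (?d i, ?d j)" unfolding map_prod_simp d(1,2) by (rule z)
      ultimately show ?thesis by blast
    qed
  next
    fix z assume "z \<in> ?A \<union> ?B"
    thus "z \<in> inversions n w"
      using r_less w_r w_pos
      by (auto simp: inversions_def insert_index_less_iff insert_index_less w_insert_index)
  qed
  moreover have "?A \<inter> ?B = {}" by (auto dest: insert_index_exclude[THEN notE] sym)
  moreover have "inj_on ?h A" for A
    by (rule inj_on_subset[of _ UNIV]) (auto intro!: prod.inj_map insert_index_inj_on)
  ultimately show ?thesis
    by (simp add: card_Un_disjoint finite_inversions card_image inj_on_def[of "\<lambda>i. (i, r)"])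
qed

context
  assumes dec: "\<And>i j. i < j \<Longrightarrow> j \<le> r \<Longrightarrow> w j < w i"
begin

text \<open>Although the deleted dot sits in row \<open>r\<close>, it is row 0 of the region that
  disappears: as \<open>w\<close> decreases up to \<open>r\<close>, witnesses in the rows before
  \<open>r\<close> can be exchanged for neighbouring ones.\<close>

lemma dot_region_delete_dot:
  assumes ij: "i < n - 1" "j < n - 1"
  shows "dot_region (n - 1) (delete_dot n w) i j \<longleftrightarrow> dot_region n w (Suc i) (Suc j)"
proof
  let ?I = "insert_index r"
  assume "dot_region (n - 1) (delete_dot n w) i j"
  then obtain a b where ab: "a \<le> i" "i \<le> b" "b < n - 1" "delete_dot n w b \<le> j" "j \<le> delete_dot n w a"
    by (auto simp: dot_region_def)
  have A: "?I a \<le> Suc i" "Suc j \<le> w (?I a)"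
    using ab by (auto simp: w_insert_index) (auto simp: insert_index_def)
  show "dot_region n w (Suc i) (Suc j)"
  proof (cases "Suc i \<le> ?I b")
    case True
    have "?I b < n" "w (?I b) \<le> Suc j" using ab by (auto simp: w_insert_index insert_index_less)
    with True A show ?thesis by (intro dot_regionI[of "?I a" _ "?I b"])
  next
    case False
    \<comment> \<open>Here \<open>b = i\<close> lies before \<open>r\<close> and is one row too
      high; the dot of value 0 replaces it.\<close>
    hence "Suc i \<le> r" using ab by (auto simp: insert_index_def split: if_splits)
    with A show ?thesis by (intro dot_regionI[of "?I a" _ r]) (auto simp: w_r r_less)
  qed
next
  let ?I = "insert_index r" and ?d = "\<lambda>i. if i < r then i else i - 1"
  assume "dot_region n w (Suc i) (Suc j)"
  then obtain a b where ab: "a \<le> Suc i" "Suc i \<le> b" "b < n" "w b \<le> Suc j" "Suc j \<le> w a"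
    by (auto simp: dot_region_def)
  have dI: "?I (?d x) = x" if "x \<noteq> r" for x using that by (auto simp: insert_index_def)
  have "\<exists>a'\<le>i. j \<le> delete_dot n w a'"
  proof (cases "a \<le> i \<or> r < a")
    case True
    have ar: "a \<noteq> r" using ab w_r by auto
    have "?d a \<le> i" using True ab by auto
    moreover have "j \<le> delete_dot n w (?d a)"
      using w_insert_index[of "?d a"] dI[OF ar] ab ij \<open>?d a \<le> i\<close> by simp
    ultimately show ?thesis by blast
  next
    case False
    moreover have "a \<noteq> r" using ab w_r by auto
    ultimately have "a = Suc i" "Suc i < r" using ab by linarith+
    \<comment> \<open>Position \<open>Suc i\<close> keeps its index, which is too large by one; the
      dot before it has an even larger value.\<close>
    hence "w (Suc i) < w i" using dec[of i "Suc i"] by simp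
    hence "j \<le> delete_dot n w i"
      using ab \<open>a = Suc i\<close> w_insert_index[of i] ij \<open>Suc i < r\<close> by simp
    thus ?thesis by blast
  qed
  moreover have "\<exists>b'\<ge>i. b' < n - 1 \<and> delete_dot n w b' \<le> j"
  proof -
    have "\<exists>x. x \<noteq> r \<and> x < n \<and> i \<le> ?d x \<and> w x \<le> Suc j"
    proof (cases "b = r")
      case False
      thus ?thesis using ab by (intro exI[of _ b]) auto
    next
      case True
      \<comment> \<open>The deleted dot cannot be the lower witness; the dot of value 1 takes over,
        which by \<open>dec\<close> is not before position \<open>r - 1\<close>.\<close>
      define x where "x = pinv w 1"
      have wx: "w x = 1" unfolding x_def using permutes_inverses(1)[OF w] .
      have "1 < n" using ij by linarith
      hence "x < n" using permutes_in_image[OF w, of x] wx by simp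
      moreover have "x \<noteq> r" using wx w_r by auto
      moreover have "i \<le> ?d x"
      proof (cases "x < r")
        case True
        have "\<not> x < r - 1"
          using dec[of x "r - 1"] dec[of "r - 1" r] wx by fastforce
        thus ?thesis using True ab \<open>b = r\<close> by simp
      qed (use ab True in auto)
      ultimately show ?thesis using wx by (intro exI[of _ x]) auto
    qed
    then obtain x where x: "x \<noteq> r" "x < n" "i \<le> ?d x" "w x \<le> Suc j" by blast
    have "?d x < n - 1" using x r_less by auto
    moreover from this have "delete_dot n w (?d x) \<le> j"
      using w_insert_index[of "?d x"] dI[OF x(1)] x(4) by simp
    ultimately show ?thesis using x(3) by blast
  qed
  ultimately show "dot_region (n - 1) (delete_dot n w) i j" by (auto simp: dot_region_def)
qed

text \<open>A cell of column 0 needs the dot \<open>(r, 0)\<close> weakly below it. Conversely,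
  \<open>r\<close> successive descents to 0 give \<open>r \<le> w 0\<close>.\<close>

lemma dot_region_first:
  assumes "i < n"
  shows "dot_region n w 0 i \<and> dot_region n w i 0 \<longleftrightarrow> i \<le> r"
proof
  assume "dot_region n w 0 i \<and> dot_region n w i 0"
  then obtain b where "i \<le> b" "w b = 0" by (auto simp: dot_region_def)
  thus "i \<le> r" using w_pos[of b] by auto
next
  assume i: "i \<le> r"
  have "k \<le> r \<Longrightarrow> k \<le> w (r - k)" for k
  proof (induction k)
    case (Suc k)
    hence "w (r - k) < w (r - Suc k)" by (intro dec) auto
    thus ?case using Suc by simp
  qed simp
  from this[of r] have "r \<le> w 0" by simp
  thus "dot_region n w 0 i \<and> dot_region n w i 0"
    using i w_r r_less by (auto intro!: dot_regionI[of 0 _ r])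
qed

text \<open>The same recurrence as for inversions: the first row and column contribute
  \<open>r\<close> full pairs.\<close>

lemma card_full_pairs_delete_dot:
  "card (full_pairs n (dot_region n w)) =
    card (full_pairs (n - 1) (dot_region (n - 1) (delete_dot n w))) + r"
proof -
  let ?h = "map_prod Suc Suc"
  let ?A = "?h ` full_pairs (n - 1) (dot_region (n - 1) (delete_dot n w))" and ?B = "Pair 0 ` {0<..r}"
  have "full_pairs n (dot_region n w) = ?A \<union> ?B"
  proof (intro equalityI subsetI)
    fix z assume "z \<in> full_pairs n (dot_region n w)"
    then obtain i j where z: "z = (i, j)" "i < j" "j < n" "dot_region n w i j" "dot_region n w j i"
      by (auto simp: full_pairs_def)
    show "z \<in> ?A \<union> ?B"
    proof (cases i)
      case 0
      thus ?thesis using z dot_region_first[of j] by auto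
    next
      case (Suc i')
      then obtain j' where j': "j = Suc j'" using z by (cases j) auto
      have "(i', j') \<in> full_pairs (n - 1) (dot_region (n - 1) (delete_dot n w))"
        using z Suc j' by (auto simp: full_pairs_def dot_region_delete_dot simp del: One_nat_def)
      thus ?thesis using z(1) Suc j' by auto
    qed
  next
    fix z assume "z \<in> ?A \<union> ?B"
    moreover have "dot_region n w 0 x" "dot_region n w x 0" if "x \<le> r" for x
      using dot_region_first[of x] r_less that by auto
    ultimately show "z \<in> full_pairs n (dot_region n w)"
      using r_less
      by (auto simp: full_pairs_def dot_region_delete_dot simp del: One_nat_def)
  qed
  moreover have "?A \<inter> ?B = {}" by auto
  moreover have "inj_on ?h A" for A by (auto simp: inj_on_def)
  ultimately show ?thesis
    by (simp add: card_Un_disjoint finite_full_pairs card_image inj_on_def[of "Pair 0"])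
qed

end
end

text \<open>Inversion reflects the dots in the diagonal and swaps the roles of the two
  witnesses.\<close>

lemma dot_region_inv:
  assumes w: "w permutes {..<n}" and "i < n" "j < n"
  shows "dot_region n (pinv w) i j \<longleftrightarrow> dot_region n w j i"
proof -
  have *: "dot_region n w j i" if "dot_region n (pinv w) i j" "w permutes {..<n}" "j < n" for w i j
  proof -
    from that(1) obtain a b where ab: "a \<le> i" "i \<le> b" "b < n" "pinv w b \<le> j" "j \<le> pinv w a"
      by (auto simp: dot_region_def)
    have "pinv w a < n" using permutes_in_image[OF permutes_inv[OF that(2)], of a] ab by simp
    thus ?thesis
      using ab permutes_inverses(1)[OF that(2)] by (intro dot_regionI[of "pinv w b" _ "pinv w a"]) auto
  qed
  show ?thesis
    using *[of w i j] *[of "pinv w" j i] permutes_inv[OF w] assms by (auto simp: permutes_inv_inv)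
qed

lemma card_full_pairs_dot_region_inv:
  assumes "w permutes {..<n}"
  shows "card (full_pairs n (dot_region n (pinv w))) = card (full_pairs n (dot_region n w))"
  by (rule arg_cong[where f = card]) (auto simp: full_pairs_def dot_region_inv[OF assms])

lemma card_inversions_inv:
  assumes w: "w permutes {..<n}"
  shows "card (inversions n (pinv w)) = card (inversions n w)"
proof (rule bij_betw_same_card[of "\<lambda>(i, j). (pinv w j, pinv w i)"],
    rule bij_betwI[where g = "\<lambda>(i, j). (w j, w i)"])
  have "pinv w i < n" "w i < n" if "i < n" for i
    using that permutes_in_image[OF permutes_inv[OF w], of i] permutes_in_image[OF w, of i] by auto
  moreover note permutes_inverses[OF w]
  ultimately show "(\<lambda>(i, j). (pinv w j, pinv w i)) \<in> inversions n (pinv w) \<rightarrow> inversions n w"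
    "(\<lambda>(i, j). (w j, w i)) \<in> inversions n w \<rightarrow> inversions n (pinv w)"
    by (auto simp: inversions_def)
qed (auto simp: permutes_inverses[OF w])

text \<open>Avoidance of \<open>3412\<close> and \<open>4231\<close>; both patterns are involutions.\<close>

definition smooth_perm :: "nat \<Rightarrow> (nat \<Rightarrow> nat) \<Rightarrow> bool" where
  "smooth_perm n w \<longleftrightarrow> (\<forall>a b c d. a < b \<and> b < c \<and> c < d \<and> d < n \<longrightarrow>
     \<not> (w c < w d \<and> w d < w a \<and> w a < w b) \<and> \<not> (w d < w b \<and> w b < w c \<and> w c < w a))"

lemma smooth_permD:
  assumes "smooth_perm n w" "a < b" "b < c" "c < d" "d < n"
  shows "w c < w d \<Longrightarrow> w d < w a \<Longrightarrow> \<not> w a < w b" "w d < w b \<Longrightarrow> w b < w c \<Longrightarrow> \<not> w c < w a"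
  using assms unfolding smooth_perm_def by blast+

lemma smooth_perm_inv:
  assumes w: "w permutes {..<n}" and s: "smooth_perm n w"
  shows "smooth_perm n (pinv w)"
  unfolding smooth_perm_def
proof (intro allI impI conjI notI; elim conjE)
  fix a b c d
  assume o: "a < b" "b < c" "c < d" "d < n"
  have less: "pinv w x < n" if "x < n" for x
    using that permutes_in_image[OF permutes_inv[OF w], of x] by simp
  note [simp] = permutes_inverses(1)[OF w]
  {
    assume "pinv w c < pinv w d" "pinv w d < pinv w a" "pinv w a < pinv w b"
    from smooth_permD(1)[OF s this] less[of b] o show False by simp
  }
  {
    assume "pinv w d < pinv w b" "pinv w b < pinv w c" "pinv w c < pinv w a"
    from smooth_permD(2)[OF s this] less[of a] o show False by simp
  }
qed

lemma smooth_perm_delete_dot: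
  assumes w: "w permutes {..<n}" and n: "0 < n" and s: "smooth_perm n w"
  shows "smooth_perm (n - 1) (delete_dot n w)"
  unfolding smooth_perm_def
proof (intro allI impI; elim conjE)
  fix a b c d
  assume o: "a < b" "b < c" "c < d" "d < n - 1"
  let ?I = "insert_index (pinv w 0)"
  have "?I a < ?I b" "?I b < ?I c" "?I c < ?I d" "?I d < n"
    using o by (auto simp: insert_index_less_iff insert_index_less)
  from smooth_permD[OF s this]
  show "\<not> (delete_dot n w c < delete_dot n w d \<and> delete_dot n w d < delete_dot n w a \<and>
      delete_dot n w a < delete_dot n w b) \<and>
    \<not> (delete_dot n w d < delete_dot n w b \<and> delete_dot n w b < delete_dot n w c \<and>
      delete_dot n w c < delete_dot n w a)"
    using o by (auto simp: w_insert_index[OF w n refl])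
qed

text \<open>If an entry smaller than \<open>w 0\<close> came after position \<open>inv w 0\<close> and an entry larger than \<open>w 0\<close> before
  it, the four would form \<open>3412\<close>; and \<open>4231\<close> makes the entries below \<open>w 0\<close> left of that position
  decreasing.\<close>

lemma smooth_perm_cases:
  assumes w: "w permutes {..<n}" and s: "smooth_perm n w" and n: "0 < n"
  obtains "\<And>i j. i < j \<Longrightarrow> j \<le> pinv w 0 \<Longrightarrow> w j < w i"
  | "\<And>i j. i < j \<Longrightarrow> j \<le> w 0 \<Longrightarrow> pinv w j < pinv w i"
proof -
  define r where "r = pinv w 0"
  have wr: "w r = 0" unfolding r_def by (rule w_r[OF w n refl])
  have rn: "r < n" unfolding r_def by (rule r_less[OF w n refl])
  have pos: "0 < w i" if "i \<noteq> r" for i using that unfolding r_def by (rule w_pos[OF w n refl])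
  have inj: "w i = w j \<longleftrightarrow> i = j" for i j using permutes_inj[OF w] by (auto dest: injD)
  have inner: "w b < w a" if "0 < a" "a < b" "b < r" "w b < w 0" for a b
    using smooth_permD(2)[OF s that(1-3) rn] that pos[of a] inj[of a b] wr
    by (cases "w a" "w b" rule: linorder_cases) auto
  show thesis
  proof (cases "\<forall>a. 0 < a \<and> a < r \<longrightarrow> w a < w 0")
    case True
    have "w j < w i" if "i < j" "j \<le> r" for i j
    proof (cases "j = r")
      case True
      thus ?thesis using wr pos[of i] that by simp
    next
      case False
      hence "j < r" using that by simp
      thus ?thesis using True inner[of i j] that by (cases "i = 0") auto
    qed
    thus ?thesis using that(1) unfolding r_def by blast
  next
    case False
    then obtain a where "0 < a" "a < r" "\<not> w a < w 0" by blast
    hence a: "0 < a" "a < r" "w 0 < w a" using inj[of 0 a] by auto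
    have high: "b < r" if "0 < w b" "w b < w 0" for b
    proof (rule ccontr)
      assume "\<not> b < r"
      moreover have "b \<noteq> r" using that wr by auto
      moreover have "b < n"
      proof (rule ccontr)
        assume "\<not> b < n"
        hence "w b = b" using permutes_not_in[OF w, of b] by simp
        thus False using \<open>\<not> b < n\<close> that permutes_in_image[OF w, of 0] n by simp
      qed
      ultimately show False using smooth_permD(1)[OF s a(1,2), of b] that a wr by simp
    qed
    \<comment> \<open>By \<open>high\<close> and \<open>inner\<close> the values strictly between 0
      and \<open>w 0\<close> occur before \<open>r\<close> in decreasing order; \<open>w 0\<close>
      itself is at position 0. So the inverse decreases down to its entry 0.\<close>
    have "pinv w j < pinv w i" if "i < j" "j \<le> w 0" for i j
    proof -
      define x y where "x = pinv w i" and "y = pinv w j"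
      have xy: "w x = i" "w y = j" unfolding x_def y_def by (simp_all add: permutes_inverses(1)[OF w])
      have x0: "0 < x" using xy that by (cases x) auto
      have "y < x"
      proof (cases "j = w 0")
        case True
        thus ?thesis using xy(2) inj[of y 0] x0 by simp
      next
        case False
        hence y: "0 < y" "y < r" using that xy high[of y] by (auto intro: Nat.gr0I)
        show ?thesis
        proof (cases "i = 0")
          case True
          thus ?thesis using xy(1) wr inj[of x r] y by simp
        next
          case False
          hence "x < r" using that xy high[of x] by simp
          show ?thesis
            using inner[of x y] xy that x0 y \<open>j \<noteq> w 0\<close> by (cases x y rule: linorder_cases) auto
        qed
      qed
      thus ?thesis unfolding x_def y_def .
    qed
    thus ?thesis using that(2) by blast
  qed
qed

text \<open>In the second case of \<open>smooth_perm_cases\<close> pass to the inverse, which transposes the region.\<close>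

lemma card_full_pairs_eq_inversions:
  assumes "w permutes {..<n}" "smooth_perm n w"
  shows "card (full_pairs n (dot_region n w)) = card (inversions n w)"
  using assms
proof (induction n arbitrary: w)
  case 0
  show ?case by (simp add: full_pairs_def inversions_def)
next
  case (Suc n)
  have step: "card (full_pairs (Suc n) (dot_region (Suc n) u)) = card (inversions (Suc n) u)"
    if u: "u permutes {..<Suc n}" "smooth_perm (Suc n) u"
      "\<And>i j. i < j \<Longrightarrow> j \<le> pinv u 0 \<Longrightarrow> u j < u i" for u
    using card_full_pairs_delete_dot[OF u(1) _ refl u(3)] card_inversions_delete_dot[OF u(1) _ refl]
      Suc.IH[of "delete_dot (Suc n) u"] delete_dot_permutes[OF u(1) _ refl]
      smooth_perm_delete_dot[OF u(1) _ u(2)] by simp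
  from smooth_perm_cases[OF Suc.prems zero_less_Suc] show ?case
  proof cases
    case 1
    thus ?thesis using step[OF Suc.prems] by blast
  next
    case 2
    note w = Suc.prems(1)
    have "card (full_pairs (Suc n) (dot_region (Suc n) (pinv w))) = card (inversions (Suc n) (pinv w))"
      by (rule step) (use 2 permutes_inv[OF w] smooth_perm_inv[OF Suc.prems] in
        \<open>auto simp: permutes_inv_inv[OF w]\<close>)
    thus ?thesis
      by (simp add: card_full_pairs_dot_region_inv[OF w] card_inversions_inv[OF w])
  qed
qed

section \<open>Bruhat order\<close>

lemma perm_length_eq: "perm_length n w = card (inversions n w)"
  by (simp add: perm_length_def inversions_def)

lemma perm_length_transpose_less:
  assumes u: "inj u" and ij: "i < j" "j < n" "u i < u j"
  shows "perm_length n u < perm_length n (u \<circ> transpose i j)"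
proof -
  let ?t = "transpose i j" and ?w = "u \<circ> transpose i j"
  \<comment> \<open>\<open>h\<close> maps inversions of \<open>u\<close> injectively to inversions of \<open>u \<circ> transpose i j\<close> and misses \<open>(i, j)\<close>.\<close>
  define h where "h = (\<lambda>(a, b). if ?t a < ?t b then (?t a, ?t b) else (a, b))"
  have "inj_on h (inversions n u)"
  proof (rule inj_onI)
    fix x y assume "x \<in> inversions n u" "y \<in> inversions n u" and h: "h x = h y"
    then obtain a b c d where xy: "x = (a, b)" "y = (c, d)" "a < b" "c < d"
      by (auto simp: inversions_def)
    have t: "?t (?t e) = e" for e by simp
    show "x = y"
    proof (cases "?t a < ?t b"; cases "?t c < ?t d")
      assume "?t a < ?t b" "?t c < ?t d"
      hence "?t a = ?t c" "?t b = ?t d" using h by (simp_all add: h_def xy)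
      thus ?thesis unfolding xy by (metis t)
    next
      assume *: "?t a < ?t b" "\<not> ?t c < ?t d"
      hence "?t a = c" "?t b = d" using h by (simp_all add: h_def xy)
      hence "?t c = a" "?t d = b" using t by blast+
      thus ?thesis using * xy by simp
    next
      assume *: "\<not> ?t a < ?t b" "?t c < ?t d"
      hence "a = ?t c" "b = ?t d" using h by (simp_all add: h_def xy)
      hence "?t a = c" "?t b = d" using t by blast+
      thus ?thesis using * xy by simp
    next
      assume "\<not> ?t a < ?t b" "\<not> ?t c < ?t d"
      thus ?thesis using h by (simp add: h_def xy)
    qed
  qed
  moreover have "h ` inversions n u \<subseteq> inversions n ?w - {(i, j)}"
  proof (intro subsetI, elim imageE)
    fix z x assume "x \<in> inversions n u" and z: "z = h x"
    then obtain a b where x: "x = (a, b)" "a < b" "b < n" "u b < u a" by (auto simp: inversions_def)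
    have "?t b < n" using x ij by (auto simp: transpose_def)
    moreover have "u (?t b) < u (?t a)" if "\<not> ?t a < ?t b"
      using that x ij by (auto simp: transpose_def split: if_splits)
    moreover have "(a, b) \<noteq> (j, i)" "(a, b) \<noteq> (i, j)" using x ij by auto
    ultimately show "z \<in> inversions n ?w - {(i, j)}"
      using x unfolding z h_def by (auto simp: inversions_def transpose_eq_iff)
  qed
  ultimately have "card (inversions n u) \<le> card (inversions n ?w - {(i, j)})"
    by (intro card_inj_on_le[of h]) (auto simp: finite_inversions)
  also have "\<dots> < card (inversions n ?w)"
    by (rule card_Diff1_less) (use ij in \<open>auto simp: finite_inversions, simp add: inversions_def\<close>)
  finally show ?thesis by (simp add: perm_length_eq)
qed

text \<open>If \<open>u i > u j\<close>, the swap could be undone by a length-increasing one, so the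
  length condition reduces to comparing two entries.\<close>

lemma bruhat_step_iff:
  "(u, w) \<in> bruhat_step n \<longleftrightarrow> u permutes {..<n} \<and> (\<exists>i j. i < j \<and> j < n \<and> w = u \<circ> transpose i j \<and> u i < u j)"
proof -
  have "u i < u j" if u: "u permutes {..<n}" and ij: "i < j" "j < n"
    and l: "perm_length n u < perm_length n (u \<circ> transpose i j)" for i j
  proof (rule ccontr)
    assume "\<not> u i < u j"
    moreover have "u i \<noteq> u j" using injD[OF permutes_inj[OF u], of i j] ij by auto
    ultimately have "(u \<circ> transpose i j) i < (u \<circ> transpose i j) j" by simp
    hence "perm_length n (u \<circ> transpose i j) < perm_length n (u \<circ> transpose i j \<circ> transpose i j)"
      using permutes_inj[OF u] ij by (intro perm_length_transpose_less) (auto intro!: inj_compose)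
    thus False using l by (simp add: comp_assoc)
  qed
  moreover have "perm_length n u < perm_length n (u \<circ> transpose i j)"
    if "u permutes {..<n}" "i < j" "j < n" "u i < u j" for i j
    using perm_length_transpose_less[OF permutes_inj] that by blast
  ultimately show ?thesis unfolding bruhat_step_def mem_Collect_eq case_prod_conv by metis
qed

lemma transpose_permutes:
  "u permutes {..<n} \<Longrightarrow> i < n \<Longrightarrow> j < n \<Longrightarrow> u \<circ> transpose i j permutes {..<n::nat}"
  by (rule permutes_compose[OF permutes_swap_id]) auto

lemma bruhat_le_refl: "u permutes {..<n} \<Longrightarrow> bruhat_le n u u"
  by (simp add: bruhat_le_def)

lemma bruhat_le_transpose:
  assumes "bruhat_le n v u" "i < j" "j < n" "u i < u j"
  shows "bruhat_le n v (u \<circ> transpose i j)"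
proof -
  have u: "u permutes {..<n}" using assms by (simp add: bruhat_le_def)
  hence "(u, u \<circ> transpose i j) \<in> bruhat_step n"
    using assms unfolding bruhat_step_iff by blast
  moreover have "u \<circ> transpose i j permutes {..<n}"
    using assms by (intro transpose_permutes u) auto
  ultimately show ?thesis
    using assms by (auto simp: bruhat_le_def intro: rtrancl_into_rtrancl)
qed

text \<open>Swapping any non-inverted pair increases the bounded length, and only the reversal has
  no such pair.\<close>

lemma bruhat_le_reverse_perm:
  assumes "u permutes {..<n}"
  shows "bruhat_le n u (reverse_perm n)"
  using assms
proof (induction "card {(i, j). i < j \<and> j < n} - perm_length n u" arbitrary: u rule: less_induct)
  case less
  show ?case
  proof (cases "\<exists>i j. i < j \<and> j < n \<and> u i < u j")
    case True
    then obtain i j where ij: "i < j" "j < n" "u i < u j" by blast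
    let ?w = "u \<circ> transpose i j"
    have w: "?w permutes {..<n}" using less.prems ij by (intro transpose_permutes) auto
    have "bruhat_le n ?w (reverse_perm n)"
      using perm_length_transpose_less[OF permutes_inj[OF less.prems] ij] perm_length_le[of n ?w]
      by (intro less.hyps w) linarith
    moreover have "(u, ?w) \<in> bruhat_step n" using less.prems ij by (auto simp: bruhat_step_iff)
    ultimately show ?thesis using less.prems
      by (auto simp: bruhat_le_def intro: converse_rtrancl_into_rtrancl)
  next
    case False
    have "u j < u i" if "i < j" "j < n" for i j
      using False that injD[OF permutes_inj[OF less.prems], of i j] by (cases "u i" "u j" rule: linorder_cases) auto
    hence "perm_length n u = card {(i, j). i < j \<and> j < n}"
      unfolding perm_length_def by (intro arg_cong[where f = card]) auto
    hence "u = reverse_perm n" by (rule perm_length_eq_max_imp_reverse[OF less.prems])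
    thus ?thesis using bruhat_le_refl[OF less.prems] by simp
  qed
qed

lemma bruhat_le_sandwiched:
  assumes "bruhat_le n v u" "i < n"
  shows "\<exists>a b. a \<le> i \<and> i \<le> b \<and> b < n \<and> v a \<le> u i \<and> u i \<le> v b"
proof -
  have "(v, u) \<in> (bruhat_step n)\<^sup>*" using assms by (simp add: bruhat_le_def)
  hence "\<forall>i<n. \<exists>a b. a \<le> i \<and> i \<le> b \<and> b < n \<and> v a \<le> u i \<and> u i \<le> v b"
  proof (induction rule: rtrancl_induct)
    case base
    show ?case by blast
  next
    case (step u w)
    then obtain p q where pq: "p < q" "q < n" "w = u \<circ> transpose p q" "u p < u q"
      by (auto simp: bruhat_step_iff)
    obtain a b where ab: "a \<le> p" "p \<le> b" "b < n" "v a \<le> u p" "u p \<le> v b"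
      using step.IH pq by (meson less_trans)
    obtain c d where cd: "c \<le> q" "q \<le> d" "d < n" "v c \<le> u q" "u q \<le> v d"
      using step.IH pq by meson
    \<comment> \<open>After the swap the lower witness of \<open>p\<close> and the upper witness of
      \<open>q\<close> serve both positions.\<close>
    have "a \<le> p \<and> p \<le> d \<and> d < n \<and> v a \<le> w p \<and> w p \<le> v d"
      "a \<le> q \<and> q \<le> d \<and> d < n \<and> v a \<le> w q \<and> w q \<le> v d"
      using ab cd pq by auto
    moreover have "w i = u i" if "i \<noteq> p" "i \<noteq> q" for i
      using that pq by (simp add: transpose_def)
    ultimately show ?case using step.IH by metis
  qed
  thus ?thesis using assms by blast
qed

text \<open>The top element imposes no condition. Conversely, at most two upward swaps bring the
  value \<open>j\<close> to position \<open>i\<close>; a first swap with \<open>a\<close> or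
  \<open>b\<close> is needed when the dots of \<open>v\<close> in row \<open>i\<close> and column
  \<open>j\<close> form an inversion.\<close>

lemma Gamma_region_longest_iff:
  assumes v: "v permutes {..<n}" and i: "i < n" and j: "j < n"
  shows "(i, j) \<in> Gamma_region n v (longest_perm n) \<longleftrightarrow>
    (\<exists>a b. a \<le> i \<and> i \<le> b \<and> b < n \<and> v a \<le> j \<and> j \<le> v b)"
proof
  assume "(i, j) \<in> Gamma_region n v (longest_perm n)"
  thus "\<exists>a b. a \<le> i \<and> i \<le> b \<and> b < n \<and> v a \<le> j \<and> j \<le> v b"
    using bruhat_le_sandwiched by (auto simp: Gamma_region_def bruhat_interval_def)
next
  assume "\<exists>a b. a \<le> i \<and> i \<le> b \<and> b < n \<and> v a \<le> j \<and> j \<le> v b"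
  then obtain a b where ab: "a \<le> i" "i \<le> b" "b < n" "v a \<le> j" "j \<le> v b" by blast
  define p where "p = inv_into UNIV v j"
  have p: "v p = j" unfolding p_def by (rule permutes_inverses(1)[OF v])
  have pn: "p < n" using permutes_in_image[OF v, of p] p j by simp
  note inj = injD[OF permutes_inj[OF v]]
  have "\<exists>u. bruhat_le n v u \<and> u i = j"
  proof -
    consider "p = i" | "p > i" "j > v i" | "p < i" "j < v i" | "p > i" "j < v i" | "p < i" "j > v i"
      using p inj[of p i] by (cases p i rule: linorder_cases; cases j "v i" rule: linorder_cases) auto
    thus ?thesis
    proof cases
      case 1
      thus ?thesis using bruhat_le_refl[OF v] p by blast
    next
      case 2
      thus ?thesis using bruhat_le_transpose[OF bruhat_le_refl[OF v], of i p] p pn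
        by (intro exI[of _ "v \<circ> transpose i p"]) auto
    next
      case 3
      thus ?thesis using bruhat_le_transpose[OF bruhat_le_refl[OF v], of p i] p i
        by (intro exI[of _ "v \<circ> transpose p i"]) auto
    next
      case 4
      have "a \<noteq> i" using 4 ab by auto
      moreover have "v a \<noteq> j" using 4 ab p inj[of a p] by auto
      ultimately have *: "a < i" "v a < j" using ab by simp_all
      let ?u = "v \<circ> transpose a i"
      have "bruhat_le n v ?u"
        using * 4 i by (intro bruhat_le_transpose bruhat_le_refl v) auto
      moreover have "?u i < ?u p" "?u p = j" using * 4 p by (auto simp: transpose_def)
      ultimately have "bruhat_le n v (?u \<circ> transpose i p)" "(?u \<circ> transpose i p) i = j"
        using 4 pn by (auto intro!: bruhat_le_transpose simp del: comp_apply, simp)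
      thus ?thesis by blast
    next
      case 5
      have "b \<noteq> i" using 5 ab by auto
      moreover have "v b \<noteq> j" using 5 ab p inj[of b p] by auto
      ultimately have *: "i < b" "j < v b" using ab by simp_all
      let ?u = "v \<circ> transpose i b"
      have "bruhat_le n v ?u"
        using * 5 ab by (intro bruhat_le_transpose bruhat_le_refl v) auto
      moreover have "?u p < ?u i" "?u p = j" using * 5 p by (auto simp: transpose_def)
      ultimately have "bruhat_le n v (?u \<circ> transpose p i)" "(?u \<circ> transpose p i) i = j"
        using 5 i by (auto intro!: bruhat_le_transpose simp del: comp_apply, simp)
      thus ?thesis by blast
    qed
  qed
  then obtain u where u: "bruhat_le n v u" "u i = j" by blast
  hence "bruhat_le n u (longest_perm n)"
    unfolding longest_perm_eq by (intro bruhat_le_reverse_perm) (simp add: bruhat_le_def)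
  thus "(i, j) \<in> Gamma_region n v (longest_perm n)"
    using u i by (auto simp: Gamma_region_def bruhat_interval_def)
qed

section \<open>Reversing the columns\<close>

lemma card_pairs_Suc: "card (pairs (Suc n)) = card (pairs n) + n"
proof -
  have "pairs (Suc n) = pairs n \<union> (\<lambda>i. (i, n)) ` {..<n}"
    by (auto simp: pairs_def less_Suc_eq)
  moreover have "pairs n \<inter> (\<lambda>i. (i, n)) ` {..<n} = {}" by (auto simp: pairs_def)
  ultimately show ?thesis
    by (simp add: card_Un_disjoint finite_pairs_below card_image inj_on_def)
qed

text \<open>Induction by expansion along row 0: column \<open>j\<close> of the reversed matrix is
  column \<open>n - j\<close> of \<open>B\<close>, and moving the expansion sign there costs
  \<open>(-1) ^ n\<close>, the growth of \<open>card (pairs n)\<close>.\<close>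

lemma fdet_reverse_columns:
  "fdet n (\<lambda>i j. B i (n - Suc j)) = (-1) ^ card (pairs n) * fdet n B"
proof (induction n arbitrary: B)
  case 0
  show ?case by (simp add: fdet_def pairs_def)
next
  case (Suc n)
  let ?C = "\<lambda>i j. B i (n - j)"
  have minor: "fdet n (minor_fun 0 j ?C) = (-1) ^ card (pairs n) * fdet n (minor_fun 0 (n - j) B)"
    if "j < Suc n" for j
  proof -
    have "fdet n (minor_fun 0 j ?C) = fdet n (\<lambda>i k. minor_fun 0 (n - j) B i (n - Suc k))"
      by (rule fdet_cong) (use that in \<open>auto simp: minor_fun_def insert_index_def Suc_diff_Suc\<close>)
    thus ?thesis using Suc.IH[of "minor_fun 0 (n - j) B"] by simp
  qed
  have "fdet (Suc n) (\<lambda>i j. B i (Suc n - Suc j)) =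
      (\<Sum>j<Suc n. ?C 0 j * (-1) ^ j * fdet n (minor_fun 0 j ?C))"
    using fdet_expand_row[of 0 "Suc n" ?C] by simp
  also have "\<dots> = (\<Sum>j<Suc n. (-1) ^ card (pairs (Suc n)) *
      (B 0 (n - j) * (-1) ^ (n - j) * fdet n (minor_fun 0 (n - j) B)))"
  proof (rule sum.cong[OF refl])
    fix j assume "j \<in> {..<Suc n}"
    hence j: "j \<le> n" by simp
    have "even (n + (n - j)) = even j" using j by simp
    hence sign: "(-1) ^ j = ((-1) ^ n * (-1) ^ (n - j) :: 'a)"
      unfolding power_add[symmetric] by (simp only: minus_one_power_iff)
    thus "?C 0 j * (-1) ^ j * fdet n (minor_fun 0 j ?C) = (-1) ^ card (pairs (Suc n)) *
        (B 0 (n - j) * (-1) ^ (n - j) * fdet n (minor_fun 0 (n - j) B))"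
      using j by (simp add: minor sign card_pairs_Suc power_add mult_ac)
  qed
  also have "\<dots> = (-1) ^ card (pairs (Suc n)) *
      (\<Sum>j<Suc n. B 0 (n - j) * (-1) ^ (n - j) * fdet n (minor_fun 0 (n - j) B))"
    by (simp only: sum_distrib_left)
  also have "(\<Sum>j<Suc n. B 0 (n - j) * (-1) ^ (n - j) * fdet n (minor_fun 0 (n - j) B)) =
      (\<Sum>j<Suc n. B 0 j * (-1) ^ j * fdet n (minor_fun 0 j B))"
    using sum.nat_diff_reindex[of "\<lambda>j. B 0 j * (-1) ^ j * fdet n (minor_fun 0 j B)" "Suc n"]
    by (simp only: diff_Suc_Suc)
  also have "\<dots> = fdet (Suc n) B"
    using fdet_expand_row[of 0 "Suc n" B] by simp
  finally show ?case .
qed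

text \<open>\<open>submatrix\<close> enumerates its index sets by \<open>pick\<close>; this turns
  that enumeration into the given increasing map.\<close>

lemma pick_image_strict_mono:
  fixes h :: "nat \<Rightarrow> nat"
  assumes h: "strict_mono_on {..<m} h" and a: "a < m"
  shows "pick (h ` {..<m}) a = h a"
proof -
  have "{x \<in> h ` {..<m}. x < h a} = h ` {..<a}"
    using a strict_mono_on_less[OF h] by auto
  moreover have "inj_on h {..<a}"
    using strict_mono_on_imp_inj_on[OF h] a by (auto intro: inj_on_subset)
  ultimately show ?thesis
    using pick_card_in_set[of "h a" "h ` {..<m}"] a by (simp add: card_image)
qed

lemma strict_mono_on_add_le:
  fixes h :: "nat \<Rightarrow> nat"
  assumes h: "strict_mono_on {..<m} h" and "a + s < m"
  shows "h a + s \<le> h (a + s)"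
  using assms(2)
proof (induction s)
  case (Suc s)
  thus ?case using strict_mono_on_less[OF h, of "a + s" "a + Suc s"] by simp
qed simp

text \<open>The chosen rows and columns may have gaps, but the staircase condition fills the
  rectangle they span. It contains a square of size \<open>m\<close>, so
  \<open>m \<le> k\<close>.\<close>

lemma full_minors_pos_k_positive:
  assumes M: "M \<in> carrier_mat n n" and kM: "k_positive k M" and Q: "finite Q"
    and k: "k = max_square_size Q" and S: "staircase n S"
    and SQ: "\<And>i j. i < n \<Longrightarrow> j < n \<Longrightarrow> S i j \<longleftrightarrow> (i, n - Suc j) \<in> Q"
  shows "full_minors_pos n S (\<lambda>i j. M $$ (i, n - Suc j))"
  unfolding full_minors_pos_def
proof (intro allI impI, elim conjE)
  fix m :: nat and f g :: "nat \<Rightarrow> nat"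
  assume f: "strict_mono_on {..<m} f" "f ` {..<m} \<subseteq> {..<n}"
    and g: "strict_mono_on {..<m} g" "g ` {..<m} \<subseteq> {..<n}"
    and full: "\<forall>i<m. \<forall>j<m. S (f i) (g j)"
  have mk: "m \<le> k"
  proof (cases m)
    case (Suc l)
    have lt: "f l < n" "g l < n" using f g Suc by auto
    have "square_region (f 0) (n - Suc (g l)) m \<subseteq> Q"
    proof
      fix z assume "z \<in> square_region (f 0) (n - Suc (g l)) m"
      then obtain s t where st: "z = (f 0 + s, n - Suc (g l) + t)" "s \<le> l" "t \<le> l"
        unfolding square_region_def Suc
        by (auto simp: less_Suc_eq_le) (metis add_le_cancel_left le_Suc_ex less_Suc_eq_le add_Suc_right)
      have fs: "f 0 + s \<le> f l"
        using strict_mono_on_add_le[OF f(1), of 0 s] strict_mono_on_add_le[OF f(1), of s "l - s"] st Suc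
        by simp
      have gt: "g 0 + t \<le> g l"
        using strict_mono_on_add_le[OF g(1), of 0 t] strict_mono_on_add_le[OF g(1), of t "l - t"] st Suc
        by simp
      have "S (f 0 + s) (g l - t)"
        by (rule staircaseD[OF S, of "f 0" "g l" "f l" "g 0"]) (use full Suc fs gt lt in auto)
      moreover have "n - Suc (g l - t) = n - Suc (g l) + t" using gt lt by linarith
      ultimately show "z \<in> Q" using SQ[of "f 0 + s" "g l - t"] st fs lt by simp
    qed
    hence "m \<le> Max {k. \<exists>a b. square_region a b k \<subseteq> Q}"
      by (intro Max_ge finite_square_sizes Q) blast
    thus ?thesis by (simp add: k max_square_size_def)
  qed simp
  \<comment> \<open>\<open>g\<close> read backwards through the column reversal, which makes it
    increasing again.\<close>
  define r where "r = (\<lambda>b. n - Suc (g (m - Suc b)))"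
  let ?I = "f ` {..<m}" and ?J = "r ` {..<m}"
  have gm: "g b < n" if "b < m" for b using g(2) that by auto
  have r: "strict_mono_on {..<m} r"
  proof (rule strict_mono_onI)
    fix a b assume "a \<in> {..<m}" "b \<in> {..<m}" "a < b"
    hence "g (m - Suc b) < g (m - Suc a)" "g (m - Suc a) < n"
      using strict_mono_on_less[OF g(1), of "m - Suc b" "m - Suc a"] gm by auto
    thus "r a < r b" by (simp add: r_def)
  qed
  have rn: "r b < n" if "b < m" for b using gm[of "m - Suc b"] that by (simp add: r_def)
  have cI: "card ?I = m" and cJ: "card ?J = m"
    using card_image[OF strict_mono_on_imp_inj_on[OF f(1)]] card_image[OF strict_mono_on_imp_inj_on[OF r]]
    by simp_all
  have "submatrix M ?I ?J = mat m m (\<lambda>(a, b). M $$ (f a, r b))"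
  proof -
    have "{i. i < dim_row M \<and> i \<in> ?I} = ?I" "{j. j < dim_col M \<and> j \<in> ?J} = ?J"
      using M f(2) rn by auto
    thus ?thesis unfolding submatrix_def
      by (intro eq_matI) (simp_all add: cI cJ pick_image_strict_mono[OF f(1)] pick_image_strict_mono[OF r])
  qed
  hence "det (submatrix M ?I ?J) = fdet m (\<lambda>a b. M $$ (f a, n - Suc (g (m - Suc b))))"
    by (simp add: fdet_def r_def)
  also have "\<dots> = (-1) ^ card (pairs m) * fdet m (\<lambda>a b. M $$ (f a, n - Suc (g b)))"
    by (rule fdet_reverse_columns)
  finally have "det (submatrix M ?I ?J) = (-1) ^ card (pairs m) * fdet m (\<lambda>a b. M $$ (f a, n - Suc (g b)))" .
  moreover have "0 < det (submatrix M ?I ?J)"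
    by (rule kM[unfolded k_positive_def, rule_format]) (use M mk cI cJ f(2) rn in auto)
  ultimately show "0 < (-1) ^ card (pairs m) * fdet m (\<lambda>i j. M $$ (f i, n - Suc (g j)))"
    by simp
qed

section \<open>Patterns, regions and lengths under reversal\<close>

lemma contains_pattern_4I:
  assumes "a < b" "b < c" "c < d" "d < n"
    and "\<And>i j. i < 4 \<Longrightarrow> j < 4 \<Longrightarrow> w ([a, b, c, d] ! i) < w ([a, b, c, d] ! j) \<longleftrightarrow> p ! i < p ! j"
    and "length p = 4"
  shows "contains_pattern n w p"
  unfolding contains_pattern_def
proof (intro exI[of _ "\<lambda>i. [a, b, c, d] ! i"] conjI)
  have 4: "i = 0 \<or> i = 1 \<or> i = 2 \<or> i = 3" if "i < 4" for i :: nat using that by linarith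
  show "strict_mono_on {..<length p} ((!) [a, b, c, d])"
    unfolding assms(6)
  proof (rule strict_mono_onI)
    fix i j :: nat assume "i \<in> {..<4}" "j \<in> {..<4}" "i < j"
    thus "[a, b, c, d] ! i < [a, b, c, d] ! j"
      using 4[of i] 4[of j] assms(1-3) by auto
  qed
  show "(!) [a, b, c, d] ` {..<length p} \<subseteq> {..<n}"
    unfolding assms(6) using 4 assms(1-4) by force
qed (use assms in auto)

text \<open>Complementing values turns \<open>1324\<close> into \<open>4231\<close> and
  \<open>2143\<close> into \<open>3412\<close>.\<close>

lemma smooth_perm_reverse:
  assumes v: "v permutes {..<n}"
    and "avoids_pattern n v [1, 3, 2, 4]" "avoids_pattern n v [2, 1, 4, 3]"
  shows "smooth_perm n (reverse_perm n \<circ> v)"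
  unfolding smooth_perm_def
proof (intro allI impI; elim conjE)
  fix a b c d
  assume o: "a < b" "b < c" "c < d" "d < n"
  have vn: "v x < n" if "x < n" for x using permutes_in_image[OF v, of x] that by simp
  have rev: "(reverse_perm n \<circ> v) x < (reverse_perm n \<circ> v) y \<longleftrightarrow> v y < v x" if "x < n" "y < n" for x y
    using vn[OF that(1)] vn[OF that(2)] by (auto simp: reverse_perm_def)
  have 4: "i = 0 \<or> i = 1 \<or> i = 2 \<or> i = 3" if "i < 4" for i :: nat using that by linarith
  have "\<not> (v d < v c \<and> v a < v d \<and> v b < v a)"
  proof
    assume *: "v d < v c \<and> v a < v d \<and> v b < v a"
    have "contains_pattern n v [2, 1, 4, 3]"
    proof (rule contains_pattern_4I[OF o])
      fix i j :: nat assume "i < 4" "j < 4"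
      from 4[OF this(1)] 4[OF this(2)] show "v ([a, b, c, d] ! i) < v ([a, b, c, d] ! j) \<longleftrightarrow> [2, 1, 4, 3 :: nat] ! i < [2, 1, 4, 3] ! j"
        by (elim disjE) (use * in simp_all)
    qed simp
    thus False using assms by simp
  qed
  moreover have "\<not> (v b < v d \<and> v c < v b \<and> v a < v c)"
  proof
    assume *: "v b < v d \<and> v c < v b \<and> v a < v c"
    have "contains_pattern n v [1, 3, 2, 4]"
    proof (rule contains_pattern_4I[OF o])
      fix i j :: nat assume "i < 4" "j < 4"
      from 4[OF this(1)] 4[OF this(2)] show "v ([a, b, c, d] ! i) < v ([a, b, c, d] ! j) \<longleftrightarrow> [1, 3, 2, 4 :: nat] ! i < [1, 3, 2, 4] ! j"
        by (elim disjE) (use * in simp_all)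
    qed simp
    thus False using assms by simp
  qed
  ultimately show "\<not> ((reverse_perm n \<circ> v) c < (reverse_perm n \<circ> v) d \<and>
      (reverse_perm n \<circ> v) d < (reverse_perm n \<circ> v) a \<and> (reverse_perm n \<circ> v) a < (reverse_perm n \<circ> v) b) \<and>
    \<not> ((reverse_perm n \<circ> v) d < (reverse_perm n \<circ> v) b \<and>
      (reverse_perm n \<circ> v) b < (reverse_perm n \<circ> v) c \<and> (reverse_perm n \<circ> v) c < (reverse_perm n \<circ> v) a)"
    using rev o by auto
qed

lemma Gamma_region_iff_dot_region:
  assumes v: "v permutes {..<n}" and ij: "i < n" "j < n"
  shows "(i, n - Suc j) \<in> Gamma_region n v (longest_perm n) \<longleftrightarrow> dot_region n (reverse_perm n \<circ> v) i j"
proof -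
  have vn: "v x < n" if "x < n" for x using permutes_in_image[OF v, of x] that by simp
  have "reverse_perm n (v x) \<le> j \<longleftrightarrow> n - Suc j \<le> v x" "j \<le> reverse_perm n (v x) \<longleftrightarrow> v x \<le> n - Suc j"
    if "x < n" for x using vn[OF that] ij by (auto simp: reverse_perm_def)
  hence "(a \<le> i \<and> i \<le> b \<and> b < n \<and> v a \<le> n - Suc j \<and> n - Suc j \<le> v b) \<longleftrightarrow>
      (a \<le> i \<and> i \<le> b \<and> b < n \<and> reverse_perm n (v b) \<le> j \<and> j \<le> reverse_perm n (v a))" for a b
    using ij by fastforce
  thus ?thesis
    using Gamma_region_longest_iff[OF v ij(1), of "n - Suc j"] ij
    by (simp add: dot_region_def)
qed

text \<open>Complementing values exchanges inversions with non-inversions.\<close>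

lemma card_inversions_reverse_perm:
  assumes v: "v permutes {..<n}"
  shows "card (inversions n (reverse_perm n \<circ> v)) + perm_length n v = card (pairs n)"
proof -
  have vn: "v x < n" if "x < n" for x using permutes_in_image[OF v, of x] that by simp
  have "pairs n = inversions n (reverse_perm n \<circ> v) \<union> inversions n v"
  proof (intro equalityI subsetI)
    fix z assume "z \<in> pairs n"
    then obtain i j where z: "z = (i, j)" "i < j" "j < n" by (auto simp: pairs_def)
    have "v i \<noteq> v j" using injD[OF permutes_inj[OF v], of i j] z by auto
    thus "z \<in> inversions n (reverse_perm n \<circ> v) \<union> inversions n v"
      using z vn[of i] vn[of j] by (auto simp: inversions_def reverse_perm_def)
  qed (auto simp: pairs_def inversions_def)
  moreover have "\<not> reverse_perm n (v j) < reverse_perm n (v i)" if "i < j" "j < n" "v j < v i" for i j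
    using vn[of i] vn[of j] that by (simp add: reverse_perm_def)
  hence "inversions n (reverse_perm n \<circ> v) \<inter> inversions n v = {}"
    by (auto simp: inversions_def)
  ultimately show ?thesis by (simp add: card_Un_disjoint finite_inversions perm_length_eq)
qed

theorem theorem3p15:
  fixes n k :: nat and v :: "nat \<Rightarrow> nat" and M :: "real mat"
  assumes "v permutes {..<n}"
    and "avoids_pattern n v [1, 3, 2, 4]"
    and "avoids_pattern n v [2, 1, 4, 3]"
    and "k = max_square_size (Gamma_region n v (longest_perm n))"
    and "M \<in> carrier_mat n n"
    and "k_positive k M"
  shows "(-1) ^ perm_length n v * det (mat_restrict (Gamma_region n v (longest_perm n)) M) > 0"
proof -
  let ?Q = "Gamma_region n v (longest_perm n)"
  define w where "w = reverse_perm n \<circ> v"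
  define S where "S = dot_region n w"
  define A where "A = (\<lambda>i j. if (i, j) \<in> ?Q then M $$ (i, j) else 0)"
  have w: "w permutes {..<n}"
    unfolding w_def by (rule permutes_compose[OF assms(1) reverse_perm_permutes])
  have smooth: "smooth_perm n w"
    unfolding w_def by (rule smooth_perm_reverse[OF assms(1-3)])
  have SQ: "S i j \<longleftrightarrow> (i, n - Suc j) \<in> ?Q" if "i < n" "j < n" for i j
    unfolding S_def w_def using Gamma_region_iff_dot_region[OF assms(1) that] by simp
  have fin: "finite ?Q" by (rule finite_subset[OF Gamma_region_subset]) simp
  have S: "staircase n S" unfolding S_def by (rule staircase_dot_region)
  have "0 < (-1) ^ card (full_pairs n S) * fdet n (restrict_fun S (\<lambda>i j. M $$ (i, n - Suc j)))"
  proof (rule fdet_restrict_sign[OF S])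
    show "corner_free n S"
      unfolding S_def by (rule corner_free_dot_region[OF _ w]) (use smooth_permD(1)[OF smooth] in blast)
    show "full_minors_pos n S (\<lambda>i j. M $$ (i, n - Suc j))"
      by (rule full_minors_pos_k_positive[OF assms(5,6) fin assms(4) S SQ])
    show "S i i" if "i < n" for i unfolding S_def by (rule dot_region_diag[OF w that])
  qed
  also have "card (full_pairs n S) = card (inversions n w)"
    unfolding S_def by (rule card_full_pairs_eq_inversions[OF w smooth])
  also have "fdet n (restrict_fun S (\<lambda>i j. M $$ (i, n - Suc j))) = fdet n (\<lambda>i j. A i (n - Suc j))"
    by (rule fdet_cong) (simp add: restrict_fun_def A_def SQ)
  \<comment> \<open>The inversions of \<open>w\<close> now occur twice in the exponent and cancel,
    leaving the length of \<open>v\<close>.\<close>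
  also have "\<dots> = (-1) ^ (card (inversions n w) + perm_length n v) * fdet n A"
    unfolding fdet_reverse_columns w_def card_inversions_reverse_perm[OF assms(1)] ..
  also have "fdet n A = det (mat_restrict ?Q M)"
    using assms(5) by (simp add: fdet_def mat_restrict_def A_def)
  finally show ?thesis by (simp add: power_add mult.assoc[symmetric] flip: power_mult_distrib)
qed

end
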